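(* Let $q>1$ and let $(u,v)$ be a weak solution of $$\mathrm{div}\Big(\frac{\nabla u}{\sqrt{1+|\nabla u|^2}}\Big)=|v|^{q-1}v,\qquad \mathrm{div}\Big(\frac{\nabla v}{\sqrt{1+|\nabla v|^2}}\Big)=|u|^{q-1}u\qquad\text{on }\mathbb R^N.$$ Then $u=-v$ a.e., and $u$ and $v$ are weak solutions of the scalar equation $-\mathrm{div}\big(\nabla w/\sqrt{1+|\nabla w|^2}\big)=|w|^{q-1}w$ on $\mathbb R^N$. In particular the system admits no nonnegative nontrivial weak solutions.
   Context: A pair $(u,v)$ is a weak solution of the system if, for some $p>1$, $u,v\in W^{1,p}_{loc}(\mathbb R^N)$, $|u|^q,|v|^q\in L^1_{loc}(\mathbb R^N)$, and for every $\phi\in C^1_0(\mathbb R^N)$: $-\int\frac{\nabla u}{\sqrt{1+|\nabla u|^2}}\cdot\nabla\phi=\int|v|^{q-1}v\phi$ and $-\int\frac{\nabla v}{\sqrt{1+|\nabla v|^2}}\cdot\nabla\phi=\int|u|^{q-1}u\phi$. Weak solutions of the scalar equation are defined analogously. *)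

theory Defs
  imports "HOL-Analysis.Analysis"
begin

definition C1c_test :: "('a::euclidean_space \<Rightarrow> real) \<Rightarrow> ('a \<Rightarrow> 'a) \<Rightarrow> bool" where
  "C1c_test phi Dphi \<longleftrightarrow>
     (\<forall>x. (phi has_derivative (\<lambda>h. Dphi x \<bullet> h)) (at x)) \<and>
     continuous_on UNIV Dphi \<and>
     compact (closure {x. phi x \<noteq> 0})"

definition Lp_loc :: "real \<Rightarrow> ('a::euclidean_space \<Rightarrow> real) \<Rightarrow> bool" where
  "Lp_loc p f \<longleftrightarrow> f \<in> borel_measurable lebesgue \<and>
     (\<forall>K. compact K \<longrightarrow> set_integrable lebesgue K (\<lambda>x. \<bar>f x\<bar> powr p))"

definition weak_gradient :: "('a::euclidean_space \<Rightarrow> real) \<Rightarrow> ('a \<Rightarrow> 'a) \<Rightarrow> bool" where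
  "weak_gradient u g \<longleftrightarrow> g \<in> borel_measurable lebesgue \<and>
     (\<forall>phi Dphi. C1c_test phi Dphi \<longrightarrow>
        (\<forall>i\<in>Basis. (\<integral>x. u x * (Dphi x \<bullet> i) \<partial>lebesgue) = - (\<integral>x. phi x * (g x \<bullet> i) \<partial>lebesgue)))"

definition W1p_loc :: "real \<Rightarrow> ('a::euclidean_space \<Rightarrow> real) \<Rightarrow> ('a \<Rightarrow> 'a) \<Rightarrow> bool" where
  "W1p_loc p u g \<longleftrightarrow> Lp_loc p u \<and> weak_gradient u g \<and> Lp_loc p (\<lambda>x. norm (g x))"

definition mc_flux :: "'a::euclidean_space \<Rightarrow> 'a" where
  "mc_flux z = z /\<^sub>R sqrt (1 + (norm z)\<^sup>2)"

definition weak_sol_system :: "real \<Rightarrow> ('a::euclidean_space \<Rightarrow> real) \<Rightarrow> ('a \<Rightarrow> real) \<Rightarrow> bool" where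
  "weak_sol_system q u v \<longleftrightarrow>
    (\<exists>p>1. \<exists>gu gv. W1p_loc p u gu \<and> W1p_loc p v gv \<and>
       Lp_loc 1 (\<lambda>x. \<bar>u x\<bar> powr q) \<and> Lp_loc 1 (\<lambda>x. \<bar>v x\<bar> powr q) \<and>
       (\<forall>phi Dphi. C1c_test phi Dphi \<longrightarrow>
          - (\<integral>x. mc_flux (gu x) \<bullet> Dphi x \<partial>lebesgue) = (\<integral>x. \<bar>v x\<bar> powr (q - 1) * v x * phi x \<partial>lebesgue) \<and>
          - (\<integral>x. mc_flux (gv x) \<bullet> Dphi x \<partial>lebesgue) = (\<integral>x. \<bar>u x\<bar> powr (q - 1) * u x * phi x \<partial>lebesgue)))"

definition weak_sol_scalar :: "real \<Rightarrow> ('a::euclidean_space \<Rightarrow> real) \<Rightarrow> bool" where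
  "weak_sol_scalar q w \<longleftrightarrow>
    (\<exists>p>1. \<exists>gw. W1p_loc p w gw \<and> Lp_loc 1 (\<lambda>x. \<bar>w x\<bar> powr q) \<and>
       (\<forall>phi Dphi. C1c_test phi Dphi \<longrightarrow>
          (\<integral>x. mc_flux (gw x) \<bullet> Dphi x \<partial>lebesgue) = (\<integral>x. \<bar>w x\<bar> powr (q - 1) * w x * phi x \<partial>lebesgue)))"

end

theory Submission
  imports Defs
begin

text \<open>
  Put \<open>w = u + v\<close>, \<open>F = A(\<nabla>u) + A(\<nabla>v)\<close> with \<open>A\<close> the mean curvature flux, and let \<open>f\<close> be the sum of
  the two right-hand sides, so that \<open>div F = f\<close> weakly. Since \<open>A\<close> is odd and monotone,
  \<open>F \<bullet> \<nabla>w \<ge> 0\<close>, and \<open>f\<close> has the sign of \<open>w\<close>. Testing with \<open>\<psi> \<cdot> arctan(w)^m\<close>, \<open>m\<close> odd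
  and \<open>\<psi>\<close> a cutoff, and using only \<open>|F| \<le> 2\<close>, one gets, with \<open>t = |arctan w|\<close> and an even integer \<open>Q \<ge> q\<close>,
  that the integral of \<open>t^(Q+m)\<close> over the ball of radius \<open>r\<close> is at most \<open>C/r\<close> times the integral of
  \<open>t^m\<close> over the ball of radius \<open>2r\<close>. Iterating \<open>N + 1\<close> times from \<open>m = 1\<close> beats the volume growth
  \<open>r^N\<close>, hence \<open>w = 0\<close>. The test function is only Sobolev; it is reached by mollifying \<open>w\<close>
  inside \<open>arctan\<close>.
\<close>

subsection \<open>Continuity of translations in \<open>L\<^sup>1\<close>\<close>


text \<open>The data are weak: the right-hand sides are only locally integrable, \<open>w\<close>
  lies in W^{1,p}_loc for some unspecified p > 1, and nothing is known at infinity. The one global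
  bound is the one on the flux. A power of \<open>w\<close> itself is therefore not a safe test
  function. Composing with arctan makes both the function and its derivative in \<open>w\<close>
  bounded, so that every term becomes a bounded, compactly supported coefficient times an L^1_loc
  function, whatever p is. The price is that the growth of the right-hand side for large
  \<open>w\<close> is lost; what survives is a lower bound by a power of t, and that is all the
  iteration uses. The parities serve as follows: with m odd, \<open>arctan^m\<close> has the sign of
  its argument and a nonnegative derivative; with Q even, Q + m is odd again, so the output of one
  step can be the input of the next. Each step costs a doubling of the radius and gains a factor
  1/r, without Hoelder or Young inequalities. Once v = -u almost everywhere, the right-hand sides
  change sign and the two equations decouple, with the same weak gradients.\<close>

lemma integrable_lborel_translate:
  fixes h :: "'a::euclidean_space \<Rightarrow> real"
  assumes "integrable lborel h"
  shows "integrable lborel (\<lambda>x. h (x + c))"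
    and "(\<integral>x. h (x + c) \<partial>lborel) = (\<integral>x. h x \<partial>lborel)"
proof -
  have [measurable]: "h \<in> borel_measurable borel"
    using assms by auto
  have "integrable (distr lborel borel ((+) c)) h"
    using assms by (simp add: lborel_distr_plus)
  then show "integrable lborel (\<lambda>x. h (x + c))"
    by (subst (asm) integrable_distr_eq) (auto simp: add.commute)
  have "(\<integral>x. h x \<partial>(distr lborel borel ((+) c))) = (\<integral>x. h (x + c) \<partial>lborel)"
    by (subst integral_distr) (auto simp: add.commute)
  then show "(\<integral>x. h (x + c) \<partial>lborel) = (\<integral>x. h x \<partial>lborel)"
    by (simp add: lborel_distr_plus)
qed

text \<open>Pointwise convergence of the indicators may fail on the frontier of \<open>U\<close>. It
  is avoided by |b - a| = 2 max(0, a - b) + (b - a): the last term integrates to 0 by translation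
  invariance, while the positive part lives on \<open>U\<close>, is dominated by its indicator and
  vanishes eventually at each point because \<open>U\<close> is open.\<close>

lemma L1_translation_open:
  fixes U :: "'a::euclidean_space set"
  assumes U: "open U" "emeasure lborel U < \<infinity>" and y: "y \<longlonglongrightarrow> 0"
  shows "(\<lambda>n. \<integral>x. \<bar>indicat_real U (x + y n) - indicat_real U x\<bar> \<partial>lborel) \<longlonglongrightarrow> 0"
proof -
  let ?a = "indicat_real U" and ?b = "\<lambda>n x. indicat_real U (x + y n)"
  have [measurable]: "U \<in> sets borel" using U by auto
  have ia: "integrable lborel ?a" using U by (simp add: integrable_real_indicator)
  have ib: "integrable lborel (?b n)" for n
    using integrable_lborel_translate(1)[OF ia] .
  have im: "integrable lborel (\<lambda>x. max 0 (?a x - ?b n x))" for n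
    using ia ib by (intro integrable_max) auto
  have eq: "(\<integral>x. \<bar>?b n x - ?a x\<bar> \<partial>lborel) = 2 * (\<integral>x. max 0 (?a x - ?b n x) \<partial>lborel)" for n
  proof -
    have "(\<integral>x. \<bar>?b n x - ?a x\<bar> \<partial>lborel) =
       (\<integral>x. 2 * max 0 (?a x - ?b n x) + (?b n x - ?a x) \<partial>lborel)"
      by (intro Bochner_Integration.integral_cong) (auto simp: max_def)
    also have "\<dots> = 2 * (\<integral>x. max 0 (?a x - ?b n x) \<partial>lborel)
        + ((\<integral>x. ?b n x \<partial>lborel) - (\<integral>x. ?a x \<partial>lborel))"
      using ia ib im by simp
    finally show ?thesis
      using integrable_lborel_translate(2)[OF ia, of "y n"] by simp
  qed
  have "(\<lambda>n. \<integral>x. max 0 (?a x - ?b n x) \<partial>lborel) \<longlonglongrightarrow> (\<integral>x. 0 \<partial>(lborel :: 'a measure))"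
  proof (rule integral_dominated_convergence[where w = ?a])
    show "AE x in lborel. (\<lambda>n. max 0 (?a x - ?b n x)) \<longlonglongrightarrow> 0"
    proof (rule AE_I2)
      fix x
      show "(\<lambda>n. max 0 (?a x - ?b n x)) \<longlonglongrightarrow> 0"
      proof (cases "x \<in> U")
        case True
        have "(\<lambda>n. x + y n) \<longlonglongrightarrow> x" using tendsto_add[OF tendsto_const y, of x] by simp
        then have "\<forall>\<^sub>F n in sequentially. x + y n \<in> U"
          using topological_tendstoD U(1) True by blast
        then have "\<forall>\<^sub>F n in sequentially. max 0 (?a x - ?b n x) = 0"
          by eventually_elim (auto simp: True)
        then show ?thesis by (rule tendsto_eventually)
      next
        case False
        then have "max 0 (?a x - ?b n x) = 0" for n by (auto simp: indicator_def)
        then show ?thesis by simp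
      qed
    qed
  qed (use ia ib in \<open>auto simp: max_def indicator_def\<close>)
  then show ?thesis unfolding eq using tendsto_mult_right_zero by fastforce
qed

text \<open>Triangle inequality; the errors at x and at x + c have the same integral, hence the
  factor 2.\<close>

lemma L1_translation_approx:
  fixes h k :: "'a::euclidean_space \<Rightarrow> real"
  assumes h: "integrable lborel h" and k: "integrable lborel k"
  shows "(\<integral>x. \<bar>h (x + c) - h x\<bar> \<partial>lborel)
    \<le> (\<integral>x. \<bar>k (x + c) - k x\<bar> \<partial>lborel) + 2 * (\<integral>x. \<bar>h x - k x\<bar> \<partial>lborel)"
proof -
  note [simp] = integrable_lborel_translate(1)[OF h] integrable_lborel_translate(1)[OF k] h k
  have d: "integrable lborel (\<lambda>x. \<bar>h x - k x\<bar>)" by simp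
  have "(\<integral>x. \<bar>h (x + c) - h x\<bar> \<partial>lborel) \<le>
    (\<integral>x. \<bar>k (x + c) - k x\<bar> + (\<bar>h (x + c) - k (x + c)\<bar> + \<bar>h x - k x\<bar>) \<partial>lborel)"
    by (intro integral_mono) auto
  also have "\<dots> = (\<integral>x. \<bar>k (x + c) - k x\<bar> \<partial>lborel) + 2 * (\<integral>x. \<bar>h x - k x\<bar> \<partial>lborel)"
    using integrable_lborel_translate(2)[OF d, of c] by simp
  finally show ?thesis .
qed

text \<open>The property holds for indicators of open sets of finite measure and is closed under L^1
  limits, sums and scaling. Outer regularity adds the Borel sets of finite measure, and induction
  over integrable functions does the rest.\<close>

lemma L1_translation_continuous_seq:
  fixes h :: "'a::euclidean_space \<Rightarrow> real"
  assumes h: "integrable lborel h" and y: "y \<longlonglongrightarrow> 0"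
  shows "(\<lambda>n. \<integral>x. \<bar>h (x + y n) - h x\<bar> \<partial>lborel) \<longlonglongrightarrow> 0"
proof -
  \<comment> \<open>Closedness in L^1: with \<open>k\<close> within e/4 of \<open>h\<close>, the two
    approximation errors cost e/2 and leave e/2 for \<open>k\<close>.\<close>
  have approx: "(\<lambda>n. \<integral>x. \<bar>h (x + y n) - h x\<bar> \<partial>lborel) \<longlonglongrightarrow> 0"
    if h: "integrable lborel h"
    and ex: "\<And>e. e > 0 \<Longrightarrow> \<exists>k. integrable lborel k \<and> (\<integral>x. \<bar>h x - k x\<bar> \<partial>lborel) < e
       \<and> (\<lambda>n. \<integral>x. \<bar>k (x + y n) - k x\<bar> \<partial>lborel) \<longlonglongrightarrow> 0" for h :: "'a \<Rightarrow> real"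
  proof (rule LIMSEQ_I)
    fix e :: real assume "e > 0"
    then obtain k where k: "integrable lborel k" "(\<integral>x. \<bar>h x - k x\<bar> \<partial>lborel) < e/4"
       "(\<lambda>n. \<integral>x. \<bar>k (x + y n) - k x\<bar> \<partial>lborel) \<longlonglongrightarrow> 0" using ex[of "e/4"] by auto
    from LIMSEQ_D[OF k(3), of "e/2"] \<open>e > 0\<close> obtain N
      where N: "\<And>n. n \<ge> N \<Longrightarrow> \<bar>\<integral>x. \<bar>k (x + y n) - k x\<bar> \<partial>lborel\<bar> < e/2" by auto
    have "\<bar>\<integral>x. \<bar>h (x + y n) - h x\<bar> \<partial>lborel\<bar> < e" if "n \<ge> N" for n
      using L1_translation_approx[OF h k(1), of "y n"] k(2) N[OF that] by simp
    then show "\<exists>N. \<forall>n\<ge>N. norm ((\<integral>x. \<bar>h (x + y n) - h x\<bar> \<partial>lborel) - 0) < e" by auto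
  qed
  show ?thesis
    using h
  proof (induction rule: integrable_induct)
    case (base A c)
    then have [measurable]: "A \<in> sets borel" by auto
    have iA: "integrable lborel (indicat_real A)" using base by (simp add: integrable_real_indicator)
    have "(\<lambda>n. \<integral>x. \<bar>indicat_real A (x + y n) - indicat_real A x\<bar> \<partial>lborel) \<longlonglongrightarrow> 0"
    proof (rule approx[OF iA])
      fix e :: real assume "e > 0"
      then obtain U where U: "open U" "A \<subseteq> U" "emeasure lborel (U - A) < e"
        using outer_regular_lborel[of A e] by auto
      have [measurable]: "U \<in> sets borel" using U by auto
      have "U = A \<union> (U - A)" using U by auto
      then have "emeasure lborel U \<le> emeasure lborel A + emeasure lborel (U - A)"
        by (metis \<open>A \<in> sets borel\<close> \<open>U \<in> sets borel\<close> emeasure_subadditive sets.Diff sets_lborel)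
      also have "\<dots> < \<infinity>" using base(2) U(3)
        by (auto simp: less_top[symmetric] order_less_imp_not_eq top_unique dest: order_less_trans)
      finally have fin: "emeasure lborel U < \<infinity>" .
      have "(\<integral>x. \<bar>indicat_real A x - indicat_real U x\<bar> \<partial>lborel) = (\<integral>x. indicat_real (U - A) x \<partial>lborel)"
        using U by (intro Bochner_Integration.integral_cong) (auto simp: indicator_def)
      also have "\<dots> = measure lborel (U - A)" by simp
      also have "\<dots> < e" using U(3) \<open>e > 0\<close>
        by (metis emeasure_eq_ennreal_measure ennreal_less_iff measure_nonneg order_less_imp_not_eq2
            top.not_eq_extremum top_greatest order_less_le_trans)
      finally show "\<exists>k. integrable lborel k \<and> (\<integral>x. \<bar>indicat_real A x - k x\<bar> \<partial>lborel) < e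
       \<and> (\<lambda>n. \<integral>x. \<bar>k (x + y n) - k x\<bar> \<partial>lborel) \<longlonglongrightarrow> 0"
        using L1_translation_open[OF U(1) fin y] fin
        by (intro exI[of _ "indicat_real U"]) (simp add: integrable_real_indicator)
    qed
    from tendsto_mult_right_zero[OF this, of "\<bar>c\<bar>"]
    show ?case
      by (simp add: abs_mult[symmetric] algebra_simps flip: integral_mult_right_zero)
  next
    case (add f g)
    note [simp] = add(1,2)[THEN integrable_lborel_translate(1)] add(1,2)
    have "(\<lambda>n. (\<integral>x. \<bar>f (x + y n) - f x\<bar> \<partial>lborel) + (\<integral>x. \<bar>g (x + y n) - g x\<bar> \<partial>lborel)) \<longlonglongrightarrow> 0"
      using tendsto_add[OF add(3,4)] by simp
    then show ?case
    proof (rule Lim_null_comparison[rotated], intro always_eventually allI)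
      fix n
      have "(\<integral>x. \<bar>f (x + y n) + g (x + y n) - (f x + g x)\<bar> \<partial>lborel)
        \<le> (\<integral>x. \<bar>f (x + y n) - f x\<bar> + \<bar>g (x + y n) - g x\<bar> \<partial>lborel)"
        by (intro integral_mono) auto
      then show "norm (\<integral>x. \<bar>f (x + y n) + g (x + y n) - (f x + g x)\<bar> \<partial>lborel)
        \<le> (\<integral>x. \<bar>f (x + y n) - f x\<bar> \<partial>lborel) + (\<integral>x. \<bar>g (x + y n) - g x\<bar> \<partial>lborel)"
        by simp
    qed
  next
    case (lim h s)
    \<comment> \<open>The approximants satisfy |s i x| \<le> 2 |h x|, hence the dominating function
      3 |h|.\<close>
    have "(\<lambda>i. \<integral>x. \<bar>h x - s i x\<bar> \<partial>lborel) \<longlonglongrightarrow> (\<integral>x. 0 \<partial>(lborel :: 'a measure))"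
    proof (rule integral_dominated_convergence[where w = "\<lambda>x. 3 * \<bar>h x\<bar>"])
      show "AE x in lborel. (\<lambda>i. \<bar>h x - s i x\<bar>) \<longlonglongrightarrow> 0"
      proof (rule AE_I2)
        fix x :: 'a
        have "(\<lambda>i. s i x) \<longlonglongrightarrow> h x" using lim(2)[of x] by simp
        then have "(\<lambda>i. \<bar>h x - s i x\<bar>) \<longlonglongrightarrow> \<bar>h x - h x\<bar>" by (intro tendsto_intros)
        then show "(\<lambda>i. \<bar>h x - s i x\<bar>) \<longlonglongrightarrow> 0" by simp
      qed
      show "AE x in lborel. norm \<bar>h x - s i x\<bar> \<le> 3 * \<bar>h x\<bar>" for i
      proof (rule AE_I2)
        fix x :: 'a
        show "norm \<bar>h x - s i x\<bar> \<le> 3 * \<bar>h x\<bar>" using lim(3)[of x i] by auto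
      qed
    qed (use lim(1,4) in auto)
    then have L: "(\<lambda>i. \<integral>x. \<bar>h x - s i x\<bar> \<partial>lborel) \<longlonglongrightarrow> 0" by simp
    show ?case
    proof (rule approx[OF lim(4)])
      fix e :: real assume "e > 0"
      from order_tendstoD(2)[OF L this] obtain i where "(\<integral>x. \<bar>h x - s i x\<bar> \<partial>lborel) < e"
        unfolding eventually_sequentially by blast
      then show "\<exists>k. integrable lborel k \<and> (\<integral>x. \<bar>h x - k x\<bar> \<partial>lborel) < e
       \<and> (\<lambda>n. \<integral>x. \<bar>k (x + y n) - k x\<bar> \<partial>lborel) \<longlonglongrightarrow> 0"
        using lim(1,5) by blast
    qed
  qed
qed

lemma L1_translation_continuous:
  fixes h :: "'a::euclidean_space \<Rightarrow> real"
  assumes h: "integrable lborel h" and "e > 0"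
  shows "\<exists>d>0. \<forall>y. norm y < d \<longrightarrow> (\<integral>x. \<bar>h (x + y) - h x\<bar> \<partial>lborel) \<le> e"
proof (rule ccontr)
  assume "\<not> ?thesis"
  then have "\<forall>n. \<exists>y. norm y < 1 / real (Suc n) \<and> (\<integral>x. \<bar>h (x + y) - h x\<bar> \<partial>lborel) > e"
    by (metis not_le of_nat_0_less_iff zero_less_Suc zero_less_divide_1_iff)
  then obtain y where y: "\<And>n. norm (y n) < 1 / real (Suc n)"
     "\<And>n. (\<integral>x. \<bar>h (x + y n) - h x\<bar> \<partial>lborel) > e" by metis
  have "y \<longlonglongrightarrow> 0"
    using y(1) by (intro Lim_null_comparison[OF _ lim_1_over_n[THEN LIMSEQ_Suc]] always_eventually)
      (auto simp: less_imp_le)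
  from L1_translation_continuous_seq[OF h this] have "(\<lambda>n. \<integral>x. \<bar>h (x + y n) - h x\<bar> \<partial>lborel) \<longlonglongrightarrow> 0" .
  from order_tendstoD(2)[OF this \<open>e > 0\<close>] obtain n where "(\<integral>x. \<bar>h (x + y n) - h x\<bar> \<partial>lborel) < e"
    unfolding eventually_sequentially by blast
  with y(2)[of n] show False by simp
qed

subsection \<open>Mollification in \<open>L\<^sup>1\<close>, locally\<close>


text \<open>A correlation rather than a convolution: the kernel is evaluated at y - x, so that for
  fixed x it is a translate of a test function in y and can be inserted directly into the definition
  of a weak gradient, without assuming \<open>\<rho>\<close> even.\<close>

definition mollify :: "('a::euclidean_space \<Rightarrow> real) \<Rightarrow> ('a \<Rightarrow> real) \<Rightarrow> 'a \<Rightarrow> real" where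
  "mollify \<rho> h x = (\<integral>y. \<rho> (y - x) * h y \<partial>lebesgue)"

definition mollifier_kernel :: "real \<Rightarrow> ('a::euclidean_space \<Rightarrow> real) \<Rightarrow> bool" where
  "mollifier_kernel d \<rho> \<longleftrightarrow> (\<exists>D\<rho>. C1c_test \<rho> D\<rho>) \<and> (\<forall>x. 0 \<le> \<rho> x)
     \<and> (\<forall>x. d \<le> norm x \<longrightarrow> \<rho> x = 0) \<and> (\<integral>x. \<rho> x \<partial>lborel) = 1"

definition loc_int :: "('a::euclidean_space \<Rightarrow> real) \<Rightarrow> bool" where
  "loc_int h \<longleftrightarrow> h \<in> borel_measurable lebesgue \<and> (\<forall>K. compact K \<longrightarrow> set_integrable lebesgue K h)"

lemma C1c_test_continuous: "C1c_test \<phi> D \<Longrightarrow> continuous_on A \<phi>"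
  unfolding C1c_test_def
  by (auto intro!: continuous_at_imp_continuous_on intro: has_derivative_continuous)

lemma C1c_test_zero_outside:
  assumes "C1c_test \<phi> D" "x \<notin> closure {x. \<phi> x \<noteq> 0}"
  shows "\<phi> x = 0" "D x = 0"
proof -
  let ?S = "closure {x. \<phi> x \<noteq> 0}"
  have z: "\<phi> y = 0" if "y \<notin> ?S" for y
    using that closure_subset[of "{x. \<phi> x \<noteq> 0}"] by auto
  show "\<phi> x = 0" using z[OF assms(2)] .
  have "(\<phi> has_derivative (\<lambda>h. D x \<bullet> h)) (at x)"
    using assms(1) unfolding C1c_test_def by (elim conjE allE)
  moreover have "(\<phi> has_derivative (\<lambda>h. 0)) (at x)"
  proof (rule has_derivative_transform_within_open[OF has_derivative_const[of 0], of "- ?S"])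
    show "x \<in> - ?S" using assms(2) by (simp only: Compl_iff not_False_eq_True)
    show "0 = \<phi> y" if "y \<in> - ?S" for y using z[OF ComplD[OF that]] by (rule sym)
  qed (rule open_Compl[OF closed_closure])
  ultimately have "(\<lambda>h. D x \<bullet> h) = (\<lambda>h. 0)" by (rule has_derivative_unique)
  then show "D x = 0" by (metis inner_eq_zero_iff)
qed

lemma C1c_test_bounded:
  assumes "C1c_test \<phi> D"
  obtains B where "B > 0" "\<And>x. \<bar>\<phi> x\<bar> \<le> B" "\<And>x. norm (D x) \<le> B"
proof -
  let ?S = "closure {x. \<phi> x \<noteq> 0}"
  have S: "compact ?S" and D: "continuous_on UNIV D" using assms unfolding C1c_test_def by auto
  have "bounded (\<phi> ` ?S)" "bounded (D ` ?S)"
    using S C1c_test_continuous[OF assms] continuous_on_subset[OF D]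
    by (auto intro!: compact_imp_bounded compact_continuous_image)
  then obtain a b where a: "\<And>x. x \<in> ?S \<Longrightarrow> \<bar>\<phi> x\<bar> \<le> a" and b: "\<And>x. x \<in> ?S \<Longrightarrow> norm (D x) \<le> b"
    unfolding bounded_iff by (metis imageI real_norm_def)
  show ?thesis
  proof
    show "max 1 (max a b) > 0" by simp
    show "\<bar>\<phi> x\<bar> \<le> max 1 (max a b)" "norm (D x) \<le> max 1 (max a b)" for x
      by (cases "x \<in> ?S"; use a[of x] b[of x] C1c_test_zero_outside[OF assms, of x] in \<open>simp add: le_max_iff_disj\<close>)+
  qed
qed

lemma borel_measurable_lebesgue_continuous:
  "continuous_on UNIV (f :: 'a::euclidean_space \<Rightarrow> 'b::euclidean_space) \<Longrightarrow> f \<in> borel_measurable lebesgue"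
  by (intro measurable_completion) (simp add: borel_measurable_continuous_onI)

lemma nn_integral_lborel_translate:
  fixes f :: "'a::euclidean_space \<Rightarrow> ennreal"
  assumes [measurable]: "f \<in> borel_measurable borel"
  shows "(\<integral>\<^sup>+x. f (x + c) \<partial>lborel) = (\<integral>\<^sup>+x. f x \<partial>lborel)"
proof -
  have "(\<integral>\<^sup>+x. f x \<partial>(distr lborel borel ((+) c))) = (\<integral>\<^sup>+x. f (x + c) \<partial>lborel)"
    by (subst nn_integral_distr) (auto simp: add.commute)
  then show ?thesis by (simp add: lborel_distr_plus)
qed

text \<open>Minkowski's integral inequality: the error is an average, with weight
  \<open>\<rho>\<close>, of the translation differences of \<open>h\<close>. Working with
  nonnegative integrals makes the exchange of integrals a matter of measurability alone.\<close>

lemma mollify_L1_bound: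
  fixes h \<rho> :: "'a::euclidean_space \<Rightarrow> real"
  assumes h: "integrable lborel h" and \<rho>: "mollifier_kernel d \<rho>" and "e > 0"
    and \<omega>: "\<And>z. norm z < d \<Longrightarrow> (\<integral>x. \<bar>h (x + z) - h x\<bar> \<partial>lborel) \<le> e"
  shows "(\<integral>\<^sup>+x. \<bar>(\<integral>y. \<rho> (y - x) * h y \<partial>lborel) - h x\<bar> \<partial>lborel) \<le> e"
proof -
  obtain D\<rho> where C: "C1c_test \<rho> D\<rho>" and nn: "\<And>x. 0 \<le> \<rho> x"
    and out: "\<And>x. d \<le> norm x \<Longrightarrow> \<rho> x = 0" and one: "(\<integral>x. \<rho> x \<partial>lborel) = 1"
    using \<rho> unfolding mollifier_kernel_def by auto
  have [measurable]: "h \<in> borel_measurable borel" using h by auto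
  have \<rho>m[measurable]: "\<rho> \<in> borel_measurable borel"
    using C1c_test_continuous[OF C] by (rule borel_measurable_continuous_onI)
  \<comment> \<open>A non-integrable function has integral 0 by convention, so total mass 1 forces
    integrability.\<close>
  have i\<rho>: "integrable lborel \<rho>"
    using one not_integrable_integral_eq by fastforce
  obtain B where B: "\<And>x. \<bar>\<rho> x\<bar> \<le> B" by (blast intro: C1c_test_bounded[OF C])
  have i1: "integrable lborel (\<lambda>y. \<rho> (y - x) * h y)" for x
    by (rule Bochner_Integration.integrable_bound[where f = "\<lambda>y. B * h y"])
      (use h B in \<open>auto simp: abs_mult intro!: mult_right_mono order_trans[OF B abs_ge_self]\<close>)
  have i2: "integrable lborel (\<lambda>y. \<rho> (y - x))" "(\<integral>y. \<rho> (y - x) \<partial>lborel) = 1" for x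
    using integrable_lborel_translate[OF i\<rho>, of "-x"] one by auto
  \<comment> \<open>Mass 1 brings h x under the integral; then substitute y = x + z.\<close>
  have pt: "ennreal \<bar>(\<integral>y. \<rho> (y - x) * h y \<partial>lborel) - h x\<bar>
      \<le> (\<integral>\<^sup>+z. ennreal (\<rho> z * \<bar>h (x + z) - h x\<bar>) \<partial>lborel)" for x
  proof -
    have "(\<integral>y. \<rho> (y - x) * h y \<partial>lborel) - h x = (\<integral>y. \<rho> (y - x) * h y - \<rho> (y - x) * h x \<partial>lborel)"
      using i1 i2 by simp
    also have "ennreal \<bar>\<dots>\<bar> \<le> (\<integral>\<^sup>+y. norm (\<rho> (y - x) * h y - \<rho> (y - x) * h x) \<partial>lborel)"
      using integral_norm_bound_ennreal[of lborel "\<lambda>y. \<rho> (y - x) * h y - \<rho> (y - x) * h x"] i1 i2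
      by simp
    also have "\<dots> = (\<integral>\<^sup>+y. ennreal (\<rho> (y - x) * \<bar>h y - h x\<bar>) \<partial>lborel)"
      by (intro nn_integral_cong) (simp add: abs_mult nn flip: right_diff_distrib)
    also have "\<dots> = (\<integral>\<^sup>+z. ennreal (\<rho> z * \<bar>h (x + z) - h x\<bar>) \<partial>lborel)"
      using nn_integral_lborel_translate[of "\<lambda>y. ennreal (\<rho> (y - x) * \<bar>h y - h x\<bar>)" x]
      by (simp add: add.commute)
    finally show ?thesis .
  qed
  have "(\<integral>\<^sup>+x. \<bar>(\<integral>y. \<rho> (y - x) * h y \<partial>lborel) - h x\<bar> \<partial>lborel)
     \<le> (\<integral>\<^sup>+x. (\<integral>\<^sup>+z. ennreal (\<rho> z * \<bar>h (x + z) - h x\<bar>) \<partial>lborel) \<partial>lborel)"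
    by (intro nn_integral_mono pt)
  also have "\<dots> = (\<integral>\<^sup>+z. (\<integral>\<^sup>+x. ennreal (\<rho> z * \<bar>h (x + z) - h x\<bar>) \<partial>lborel) \<partial>lborel)"
    by (rule lborel_pair.Fubini') measurable
  also have "\<dots> \<le> (\<integral>\<^sup>+z. ennreal (e * \<rho> z) \<partial>lborel)"
  proof (rule nn_integral_mono)
    fix z
    have it: "integrable lborel (\<lambda>x. \<rho> z * \<bar>h (x + z) - h x\<bar>)"
      using integrable_lborel_translate(1)[OF h, of z] h by simp
    have "(\<integral>\<^sup>+x. ennreal (\<rho> z * \<bar>h (x + z) - h x\<bar>) \<partial>lborel)
        = ennreal (\<integral>x. \<rho> z * \<bar>h (x + z) - h x\<bar> \<partial>lborel)"
      using it by (rule nn_integral_eq_integral) (simp add: nn)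
    also have "\<dots> \<le> ennreal (e * \<rho> z)"
    proof (rule ennreal_leI)
      show "(\<integral>x. \<rho> z * \<bar>h (x + z) - h x\<bar> \<partial>lborel) \<le> e * \<rho> z"
      proof (cases "norm z < d")
        case True
        then show ?thesis using mult_left_mono[OF \<omega> nn, of z z] by (simp add: mult.commute)
      qed (simp add: out)
    qed
    finally show "(\<integral>\<^sup>+x. ennreal (\<rho> z * \<bar>h (x + z) - h x\<bar>) \<partial>lborel) \<le> ennreal (e * \<rho> z)" .
  qed
  also have "\<dots> = ennreal (\<integral>z. e * \<rho> z \<partial>lborel)"
    using i\<rho> \<open>e > 0\<close> by (intro nn_integral_eq_integral) (auto simp: nn)
  also have "\<dots> = e" using one by simp
  finally show ?thesis .
qed

lemma loc_int_mult:
  fixes h k :: "'a::euclidean_space \<Rightarrow> real"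
  assumes h: "loc_int h" and k: "k \<in> borel_measurable lebesgue" "\<And>x. \<bar>k x\<bar> \<le> B"
    and K: "compact K" "\<And>x. x \<notin> K \<Longrightarrow> k x = 0"
  shows "integrable lebesgue (\<lambda>x. k x * h x)"
proof (rule Bochner_Integration.integrable_bound)
  show "integrable lebesgue (\<lambda>x. B * (indicat_real K x *\<^sub>R h x))"
    using h K(1) by (simp add: loc_int_def set_integrable_def)
  show "(\<lambda>x. k x * h x) \<in> borel_measurable lebesgue"
    using h k(1) unfolding loc_int_def by auto
  have "\<bar>k x * h x\<bar> \<le> \<bar>B * (indicat_real K x *\<^sub>R h x)\<bar>" for x
    using k(2)[of x] K(2)[of x] by (cases "x \<in> K") (auto simp: abs_mult intro!: mult_right_mono)
  then show "AE x in lebesgue. norm (k x * h x) \<le> norm (B * (indicat_real K x *\<^sub>R h x))" by simp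
qed

lemma mollify_L1_loc:
  fixes h :: "'a::euclidean_space \<Rightarrow> real" and e :: real
  assumes h: "loc_int h" and K: "compact K" and "e > 0"
  obtains d where "d > 0" "\<And>\<rho> d'. mollifier_kernel d' \<rho> \<Longrightarrow> d' \<le> d \<Longrightarrow>
    (\<integral>\<^sup>+x. ennreal (indicat_real K x * \<bar>mollify \<rho> h x - h x\<bar>) \<partial>lebesgue) \<le> e"
proof -
  obtain R where R: "K \<subseteq> cball 0 R" using compact_imp_bounded[OF K] unfolding bounded_iff by (auto simp: subset_eq)
  \<comment> \<open>Kernels of radius at most 1 will be used, so on \<open>K\<close> the
    mollification sees \<open>h\<close> only in this larger ball, and \<open>h\<close> may be
    truncated there.\<close>
  let ?C = "cball 0 (R + 1) :: 'a set"
  \<comment> \<open>The translation results concern Borel functions; a Lebesgue measurable function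
    is replaced by a Borel one that agrees almost everywhere.\<close>
  obtain hb where hb[measurable]: "hb \<in> borel_measurable lborel" and eq: "AE x in lborel. h x = hb x"
    using h completion_ex_borel_measurable_real[of h lborel] unfolding loc_int_def by auto
  have eq': "AE x in lebesgue. h x = hb x" using eq by (rule AE_completion)
  define k where "k x = indicat_real ?C x * hb x" for x
  have hb'[measurable]: "hb \<in> borel_measurable borel" using hb by simp
  have km[measurable]: "k \<in> borel_measurable lborel"
    unfolding k_def by (intro borel_measurable_times borel_measurable_indicator hb) simp
  have "integrable lebesgue k"
  proof -
    have "integrable lebesgue (\<lambda>x. indicat_real ?C x *\<^sub>R h x)"
      using h by (simp add: loc_int_def set_integrable_def)
    then show ?thesis
      by (rule integrable_cong_AE_imp) (use eq' in \<open>auto simp: k_def intro: measurable_completion\<close>)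
  qed
  then have ik: "integrable lborel k" using integrable_completion[of k lborel] km by simp
  obtain d where d: "d > 0" "\<And>y. norm y < d \<Longrightarrow> (\<integral>x. \<bar>k (x + y) - k x\<bar> \<partial>lborel) \<le> e"
    using L1_translation_continuous[OF ik \<open>e > 0\<close>] by blast
  show thesis
  proof (rule that[of "min 1 d"])
    fix \<rho> :: "'a \<Rightarrow> real" and d' assume \<rho>: "mollifier_kernel d' \<rho>" and d': "d' \<le> min 1 d"
    obtain D\<rho> where C: "C1c_test \<rho> D\<rho>" and out: "\<And>x. d' \<le> norm x \<Longrightarrow> \<rho> x = 0"
      using \<rho> unfolding mollifier_kernel_def by auto
    have [measurable]: "\<rho> \<in> borel_measurable borel"
      using C1c_test_continuous[OF C] by (rule borel_measurable_continuous_onI)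
    have moll: "mollify \<rho> h x = (\<integral>y. \<rho> (y - x) * k y \<partial>lborel)" if "x \<in> K" for x
    proof -
      have m1: "(\<lambda>y. \<rho> (y - x) * k y) \<in> borel_measurable lborel" by measurable
      have m2: "(\<lambda>y. \<rho> (y - x)) \<in> borel_measurable lebesgue"
        by (rule measurable_completion) measurable
      have "mollify \<rho> h x = (\<integral>y. \<rho> (y - x) * k y \<partial>lebesgue)"
        unfolding mollify_def
      proof (rule integral_cong_AE)
        show "AE y in lebesgue. \<rho> (y - x) * h y = \<rho> (y - x) * k y"
          using eq'
        proof eventually_elim
          case (elim y)
          show ?case
          proof (cases "norm (y - x) < d'")
            case True
            have "norm x \<le> R" using R that by auto
            then have "norm y \<le> R + 1" using True d' norm_triangle_sub[of y x] by auto
            then show ?thesis using elim by (simp add: k_def)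
          qed (use out[of "y - x"] in simp)
        qed
      qed (use h m1 m2 in \<open>auto simp: loc_int_def intro: measurable_completion\<close>)
      also have "\<dots> = (\<integral>y. \<rho> (y - x) * k y \<partial>lborel)"
        using m1 by (rule integral_completion)
      finally show ?thesis .
    qed
    have "(\<integral>\<^sup>+x. ennreal (indicat_real K x * \<bar>mollify \<rho> h x - h x\<bar>) \<partial>lebesgue)
       \<le> (\<integral>\<^sup>+x. \<bar>(\<integral>y. \<rho> (y - x) * k y \<partial>lborel) - k x\<bar> \<partial>lebesgue)"
    proof (rule nn_integral_mono_AE)
      show "AE x in lebesgue. ennreal (indicat_real K x * \<bar>mollify \<rho> h x - h x\<bar>)
         \<le> ennreal \<bar>(\<integral>y. \<rho> (y - x) * k y \<partial>lborel) - k x\<bar>"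
        using eq'
      proof eventually_elim
        case (elim x)
        show ?case
        proof (cases "x \<in> K")
          case True
          then have "k x = h x" using R elim by (auto simp: k_def)
          then show ?thesis using moll[OF True] True by simp
        qed simp
      qed
    qed
    also have "\<dots> = (\<integral>\<^sup>+x. \<bar>(\<integral>y. \<rho> (y - x) * k y \<partial>lborel) - k x\<bar> \<partial>lborel)"
      by (rule nn_integral_completion)
    also have "\<dots> \<le> e"
      using mollify_L1_bound[OF ik \<rho> \<open>e > 0\<close>] d(2) d' by auto
    finally show "(\<integral>\<^sup>+x. ennreal (indicat_real K x * \<bar>mollify \<rho> h x - h x\<bar>) \<partial>lebesgue) \<le> e" .
  qed (use d in auto)
qed

subsection \<open>Smoothness of mollifications\<close>


lemma C1c_test_support_ball:
  fixes \<phi> :: "'a::euclidean_space \<Rightarrow> real"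
  assumes "C1c_test \<phi> D"
  shows "\<exists>R>0. \<forall>x. R < norm x \<longrightarrow> \<phi> x = 0 \<and> D x = 0"
proof -
  have "compact (closure {x. \<phi> x \<noteq> 0})" using assms unfolding C1c_test_def by (elim conjE)
  then obtain R where R: "R > 0" "\<And>x. x \<in> closure {x. \<phi> x \<noteq> 0} \<Longrightarrow> norm x \<le> R"
    using bounded_pos compact_imp_bounded by metis
  show ?thesis
  proof (intro exI conjI allI impI)
    show "R > 0" by (rule R)
  next
    fix x :: 'a assume "R < norm x"
    then have "x \<notin> closure {x. \<phi> x \<noteq> 0}" using R(2)[of x] by linarith
    from C1c_test_zero_outside[OF assms this] show "\<phi> x = 0" "D x = 0" by simp_all
  qed
qed

text \<open>The radius is uniform in the base point z, which permits differentiation under the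
  integral sign in one stroke. It comes from uniform continuity of \<open>D\<close> and the mean
  value inequality for the map y \<mapsto> \<phi> y - D z \<bullet> y.\<close>

lemma C1c_test_uniform_derivative:
  fixes \<phi> :: "'a::euclidean_space \<Rightarrow> real"
  assumes C: "C1c_test \<phi> D" and "e > 0"
  shows "\<exists>d>0. \<forall>z k. norm k < d \<longrightarrow> \<bar>\<phi> (z + k) - \<phi> z - D z \<bullet> k\<bar> \<le> e * norm k"
proof -
  obtain R where R: "R > 0" "\<And>x. R < norm x \<Longrightarrow> \<phi> x = 0 \<and> D x = 0"
    using C1c_test_support_ball[OF C] by blast
  have D: "continuous_on UNIV D" and der: "\<And>x. (\<phi> has_derivative (\<lambda>h. D x \<bullet> h)) (at x)"
    using C unfolding C1c_test_def by auto
  have "uniformly_continuous_on (cball 0 (R + 1)) D"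
    by (intro compact_uniformly_continuous continuous_on_subset[OF D]) auto
  then obtain d where d: "d > 0"
     "\<And>x y. x \<in> cball 0 (R+1) \<Longrightarrow> y \<in> cball 0 (R+1) \<Longrightarrow> dist y x < d \<Longrightarrow> dist (D y) (D x) < e"
    unfolding uniformly_continuous_on_def using \<open>e > 0\<close> by metis
  \<comment> \<open>Distances are kept below 1 so that if one point leaves the ball of radius R + 1,
    both lie outside radius R, where \<open>D\<close> vanishes.\<close>
  have unif: "norm (D y - D x) \<le> e" if "dist y x < min 1 d" for x y
  proof (cases "norm x \<le> R + 1 \<and> norm y \<le> R + 1")
    case True
    then show ?thesis using d(2)[of x y] that by (auto simp: dist_norm)
  next
    case False
    have "norm x \<le> norm y + dist y x" "norm y \<le> norm x + dist y x"
      using norm_triangle_sub[of x y] norm_triangle_sub[of y x] by (auto simp: dist_norm norm_minus_commute)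
    then have "R < norm x" "R < norm y" using False that by auto
    then show ?thesis using R(2) \<open>e > 0\<close> by auto
  qed
  have "\<bar>\<phi> (z + k) - \<phi> z - D z \<bullet> k\<bar> \<le> e * norm k" if k: "norm k < min 1 d" for z k
  proof -
    let ?g = "\<lambda>y. \<phi> y - D z \<bullet> y"
    have "norm (?g (z + k) - ?g z) \<le> e * norm ((z + k) - z)"
    proof (rule differentiable_bound[where S = "ball z (min 1 d)" and f' = "\<lambda>y h. (D y - D z) \<bullet> h"])
      show "(?g has_derivative (\<lambda>h. (D y - D z) \<bullet> h)) (at y within ball z (min 1 d))" for y
        using has_derivative_at_withinI[OF der, of y "ball z (min 1 d)"]
        by (auto intro!: derivative_eq_intros simp: inner_diff_left)
      show "onorm (\<lambda>h. (D y - D z) \<bullet> h) \<le> e" if "y \<in> ball z (min 1 d)" for y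
      proof (rule onorm_le)
        fix h
        have "norm ((D y - D z) \<bullet> h) \<le> norm (D y - D z) * norm h"
          using Cauchy_Schwarz_ineq2 by simp
        also have "\<dots> \<le> e * norm h"
          using unif[of y z] that by (intro mult_right_mono) (auto simp: dist_commute)
        finally show "norm ((D y - D z) \<bullet> h) \<le> e * norm h" .
      qed
      show "z + k \<in> ball z (min 1 d)" using k by (simp add: dist_norm)
    qed (use d(1) in auto)
    then show ?thesis by (simp add: inner_add_right algebra_simps)
  qed
  then show ?thesis using d(1) by (intro exI[of _ "min 1 d"]) auto
qed

lemma mollify_has_derivative:
  fixes h \<rho> :: "'a::euclidean_space \<Rightarrow> real"
  assumes C: "C1c_test \<rho> D" and h: "loc_int h"
  shows "(mollify \<rho> h has_derivative (\<lambda>k. - (\<integral>y. (D (y - x) \<bullet> k) * h y \<partial>lebesgue))) (at x)"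
proof -
  obtain R where R: "R > 0" "\<And>x. R < norm x \<Longrightarrow> \<rho> x = 0 \<and> D x = 0"
    using C1c_test_support_ball[OF C] by blast
  obtain B where B: "B > 0" "\<And>x. \<bar>\<rho> x\<bar> \<le> B" "\<And>x. norm (D x) \<le> B"
    by (blast intro: C1c_test_bounded[OF C])
  have D: "continuous_on UNIV D" using C unfolding C1c_test_def by auto
  have cD: "continuous_on UNIV (\<lambda>y. D (y - z))" for z
    by (rule continuous_on_compose2[OF D]) (auto intro!: continuous_intros)
  have c\<rho>: "continuous_on UNIV (\<lambda>y. \<rho> (y - z))" for z
    by (rule continuous_on_compose2[OF C1c_test_continuous[OF C, of UNIV]]) (auto intro!: continuous_intros)
  have bD: "\<bar>D y \<bullet> k\<bar> \<le> B * norm k" for y k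
    using Cauchy_Schwarz_ineq2[of "D y" k] mult_right_mono[OF B(3), of "norm k" y] by auto
  have i1: "integrable lebesgue (\<lambda>y. \<rho> (y - z) * h y)" for z
    by (rule loc_int_mult[OF h, where K = "cball z R" and B = B])
      (use B R c\<rho> in \<open>auto intro!: borel_measurable_lebesgue_continuous simp: dist_norm norm_minus_commute\<close>)
  have i2: "integrable lebesgue (\<lambda>y. (D (y - z) \<bullet> k) * h y)" for z k
    by (rule loc_int_mult[OF h, where K = "cball z R" and B = "B * norm k"])
      (use bD R cD in \<open>auto intro!: borel_measurable_lebesgue_continuous continuous_intros
         simp: dist_norm norm_minus_commute\<close>)
  \<comment> \<open>The minus sign arises because the variable x enters the kernel as y - x.\<close>
  let ?f' = "\<lambda>k. - (\<integral>y. (D (y - x) \<bullet> k) * h y \<partial>lebesgue)"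
  have lin: "linear ?f'"
    by (rule linearI) (use i2 in \<open>auto simp: inner_add_right distrib_right mult.assoc\<close>)
  define M where "M = (\<integral>y. \<bar>indicat_real (cball x (R + 1)) y * h y\<bar> \<partial>lebesgue)"
  have iM: "integrable lebesgue (\<lambda>y. \<bar>indicat_real (cball x (R + 1)) y * h y\<bar>)"
    by (intro integrable_abs loc_int_mult[OF h, where K = "cball x (R + 1)" and B = 1])
      (use borel_measurable_indicator[of "cball x (R + 1)" lebesgue] in \<open>auto split: split_indicator\<close>)
  have M0: "M \<ge> 0" unfolding M_def by simp
  have "\<exists>d>0. \<forall>y. norm (y - x) < d \<longrightarrow>
     norm (mollify \<rho> h y - mollify \<rho> h x - ?f' (y - x)) \<le> e * norm (y - x)" if "e > 0" for e
  proof -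
    \<comment> \<open>The first-order error of the kernel is at most e' times the increment, and
      integration against |h| multiplies it by \<open>M\<close>; the summand 1 guards against M =
      0.\<close>
    define e' where "e' = e / (M + 1)"
    have e': "e' > 0" "e' * M \<le> e" using \<open>e > 0\<close> M0 by (auto simp: e'_def field_simps)
    obtain d where d: "d > 0" "\<And>z k. norm k < d \<Longrightarrow> \<bar>\<rho> (z + k) - \<rho> z - D z \<bullet> k\<bar> \<le> e' * norm k"
      using C1c_test_uniform_derivative[OF C e'(1)] by blast
    have "norm (mollify \<rho> h y - mollify \<rho> h x - ?f' (y - x)) \<le> e * norm (y - x)"
      if y: "norm (y - x) < min 1 d" for y
    proof -
      let ?F = "\<lambda>t. (\<rho> (t - y) - \<rho> (t - x) + D (t - x) \<bullet> (y - x)) * h t"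
      have "mollify \<rho> h y - mollify \<rho> h x - ?f' (y - x)
         = (\<integral>t. \<rho> (t - y) * h t - \<rho> (t - x) * h t + (D (t - x) \<bullet> (y - x)) * h t \<partial>lebesgue)"
        unfolding mollify_def using i1 i2 by simp
      also have "\<dots> = (\<integral>t. ?F t \<partial>lebesgue)"
        by (simp add: algebra_simps)
      finally have eq: "mollify \<rho> h y - mollify \<rho> h x - ?f' (y - x) = (\<integral>t. ?F t \<partial>lebesgue)" .
      \<comment> \<open>Since |y - x| < 1, all three kernel terms vanish outside the ball of radius
        R + 1 about x.\<close>
      have pt: "\<bar>?F t\<bar> \<le> e' * norm (y - x) * \<bar>indicat_real (cball x (R + 1)) t * h t\<bar>" for t
      proof (cases "norm (t - x) \<le> R + 1")
        case True
        have "\<bar>\<rho> (t - y) - \<rho> (t - x) + D (t - x) \<bullet> (y - x)\<bar> \<le> e' * norm (y - x)"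
          using d(2)[of "x - y" "t - x"] y
          by (simp add: norm_minus_commute inner_diff_right algebra_simps)
        then show ?thesis using True
          by (simp add: abs_mult dist_norm norm_minus_commute mult_right_mono)
      next
        case False
        have "norm (t - x) \<le> norm (t - y) + norm (y - x)"
          using norm_triangle_ineq[of "t - y" "y - x"] by simp
        then have "R < norm (t - x)" "R < norm (t - y)" using False y by auto
        then show ?thesis using R(2) e'(1) by simp
      qed
      have "\<bar>\<integral>t. ?F t \<partial>lebesgue\<bar> \<le> (\<integral>t. \<bar>?F t\<bar> \<partial>lebesgue)"
        using integral_norm_bound[of lebesgue ?F] by simp
      also have "\<dots> \<le> (\<integral>t. e' * norm (y - x) * \<bar>indicat_real (cball x (R + 1)) t * h t\<bar> \<partial>lebesgue)"
      proof (rule integral_mono)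
        have "integrable lebesgue (\<lambda>t. \<rho> (t - y) * h t - \<rho> (t - x) * h t + (D (t - x) \<bullet> (y - x)) * h t)"
          using i1 i2 by auto
        then show "integrable lebesgue (\<lambda>t. \<bar>?F t\<bar>)"
          by (intro integrable_abs) (simp add: algebra_simps)
      qed (use iM pt in auto)
      also have "\<dots> = (e' * M) * norm (y - x)" unfolding M_def by simp
      also have "\<dots> \<le> e * norm (y - x)" using e'(2) by (intro mult_right_mono) auto
      finally show ?thesis using eq by simp
    qed
    then show ?thesis using d(1) by (intro exI[of _ "min 1 d"]) auto
  qed
  then show ?thesis
    unfolding has_derivative_at_alt using lin by (auto simp: linear_conv_bounded_linear)
qed

lemma mollify_continuous:
  assumes "C1c_test \<rho> D" "loc_int h"
  shows "continuous_on UNIV (mollify \<rho> h)"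
  using has_derivative_continuous[OF mollify_has_derivative[OF assms]]
  by (auto intro!: continuous_at_imp_continuous_on)

lemma C1c_test_translate:
  assumes C: "C1c_test \<rho> D"
  shows "C1c_test (\<lambda>y. \<rho> (y - x)) (\<lambda>y. D (y - x))"
proof -
  have D: "continuous_on UNIV D" and der: "\<And>x. (\<rho> has_derivative (\<lambda>h. D x \<bullet> h)) (at x)"
    using C unfolding C1c_test_def by auto
  obtain R where R: "R > 0" "\<And>x. R < norm x \<Longrightarrow> \<rho> x = 0 \<and> D x = 0"
    using C1c_test_support_ball[OF C] by blast
  have "norm y \<le> norm x + R" if "\<rho> (y - x) \<noteq> 0" for y
    using R(2)[of "y - x"] that norm_triangle_sub[of y x] by force
  then have "bounded {y. \<rho> (y - x) \<noteq> 0}" unfolding bounded_iff by blast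
  moreover have "((\<lambda>y. \<rho> (y - x)) has_derivative (\<lambda>h. D (y - x) \<bullet> h)) (at y)" for y
  proof -
    have "((\<lambda>y. y - x) has_derivative (\<lambda>h. h)) (at y)" by (auto intro!: derivative_eq_intros)
    from has_derivative_compose[OF this der] show ?thesis .
  qed
  moreover have "continuous_on UNIV (\<lambda>y. D (y - x))"
    by (rule continuous_on_compose2[OF D]) (auto intro!: continuous_intros)
  ultimately show ?thesis unfolding C1c_test_def by simp
qed

text \<open>Mollification commutes with weak differentiation: the translated kernel is a test
  function, and the minus sign from differentiating in x cancels the one in the definition of the
  weak gradient. Basis directions suffice by linearity.\<close>

lemma mollify_gradient:
  fixes h \<rho> :: "'a::euclidean_space \<Rightarrow> real"
  assumes C: "C1c_test \<rho> D" and h: "loc_int h" and g: "weak_gradient h g"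
  shows "(mollify \<rho> h has_derivative (\<lambda>k. (\<Sum>i\<in>Basis. mollify \<rho> (\<lambda>y. g y \<bullet> i) x *\<^sub>R i) \<bullet> k)) (at x)"
proof -
  define f' where "f' k = - (\<integral>y. (D (y - x) \<bullet> k) * h y \<partial>lebesgue)" for k
  have der: "(mollify \<rho> h has_derivative f') (at x)"
    unfolding f'_def[abs_def] by (rule mollify_has_derivative[OF C h])
  then have lin: "linear f'" by (rule has_derivative_linear)
  have comp: "f' i = mollify \<rho> (\<lambda>y. g y \<bullet> i) x" if "i \<in> Basis" for i
    using g C1c_test_translate[OF C, of x] that
    unfolding weak_gradient_def mollify_def f'_def by (simp add: mult.commute)
  have "f' k = (\<Sum>i\<in>Basis. mollify \<rho> (\<lambda>y. g y \<bullet> i) x *\<^sub>R i) \<bullet> k" for k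
  proof -
    have "f' k = f' (\<Sum>i\<in>Basis. (k \<bullet> i) *\<^sub>R i)" by (simp only: euclidean_representation)
    also have "\<dots> = (\<Sum>i\<in>Basis. (k \<bullet> i) *\<^sub>R f' i)"
      using lin by (simp add: linear_sum linear_scale)
    also have "\<dots> = (\<Sum>i\<in>Basis. mollify \<rho> (\<lambda>y. g y \<bullet> i) x *\<^sub>R i) \<bullet> k"
      unfolding inner_sum_left by (intro sum.cong refl) (simp only: comp, simp add: inner_commute)
    finally show ?thesis .
  qed
  then have "f' = (\<lambda>k. (\<Sum>i\<in>Basis. mollify \<rho> (\<lambda>y. g y \<bullet> i) x *\<^sub>R i) \<bullet> k)" by (rule ext)
  with der show ?thesis by simp
qed

section \<open>Explicit C^1 bumps and the existence of mollifier kernels\<close>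

text \<open>Squaring the positive part makes it C^1 across the sphere of radius r. The same function
  serves as mollifier kernel, after normalisation, and as cutoff: its height is of order r^4 and its
  gradient of order r^3, which yields the gain 1/r of the energy estimate.\<close>

definition bump :: "real \<Rightarrow> 'a::euclidean_space \<Rightarrow> real" where
  "bump r x = (max 0 (r\<^sup>2 - x \<bullet> x))\<^sup>2"

definition bump_grad :: "real \<Rightarrow> 'a::euclidean_space \<Rightarrow> 'a" where
  "bump_grad r x = (- 4 * max 0 (r\<^sup>2 - x \<bullet> x)) *\<^sub>R x"

lemma DERIV_max_0_square: "((\<lambda>t. (max 0 t)\<^sup>2) has_real_derivative 2 * max 0 t) (at t)"
proof -
  have "((\<lambda>s. (max 0 s)\<^sup>2) has_derivative (\<lambda>h. 2 * max 0 t * h)) (at t)"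
    unfolding has_derivative_at_alt
  proof (intro conjI allI impI)
    fix e :: real assume "e > 0"
    \<comment> \<open>In every combination of signs the first-order remainder is at most quadratic,
      so the derivative exists also at the corner 0.\<close>
    have "\<bar>(max 0 s)\<^sup>2 - (max 0 t)\<^sup>2 - 2 * max 0 t * (s - t)\<bar> \<le> (s - t)\<^sup>2" for s
    proof (cases "s \<ge> 0"; cases "t \<ge> 0")
      assume "s \<ge> 0" "t \<ge> 0"
      have "s\<^sup>2 - t\<^sup>2 - 2 * t * (s - t) = (s - t)\<^sup>2" by (simp add: power2_eq_square algebra_simps)
      then show ?thesis using \<open>s \<ge> 0\<close> \<open>t \<ge> 0\<close> by simp
    next
      assume "s \<ge> 0" "\<not> t \<ge> 0"
      then have "s\<^sup>2 \<le> (s - t)\<^sup>2" by (intro power_mono) auto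
      then show ?thesis using \<open>s \<ge> 0\<close> \<open>\<not> t \<ge> 0\<close> by simp
    next
      assume "\<not> s \<ge> 0" "t \<ge> 0"
      have st: "s * t \<le> 0" using \<open>\<not> s \<ge> 0\<close> \<open>t \<ge> 0\<close> by (simp add: mult_nonpos_nonneg)
      have "- t\<^sup>2 - 2 * t * (s - t) = t\<^sup>2 - 2 * (s * t)"
        by (simp add: power2_eq_square algebra_simps)
      then have "\<bar>- t\<^sup>2 - 2 * t * (s - t)\<bar> = t\<^sup>2 - 2 * (s * t)"
        using st zero_le_power2[of t] by linarith
      also have "\<dots> \<le> (s - t)\<^sup>2" using zero_le_power2[of s]
        by (simp add: power2_diff)
      finally show ?thesis using \<open>\<not> s \<ge> 0\<close> \<open>t \<ge> 0\<close> by simp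
    qed simp
    then have "norm ((max 0 s)\<^sup>2 - (max 0 t)\<^sup>2 - 2 * max 0 t * (s - t)) \<le> e * norm (s - t)"
      if "norm (s - t) < e" for s
      using that order_trans[OF _ mult_right_mono[of "\<bar>s - t\<bar>" e "\<bar>s - t\<bar>"]]
      by (simp add: power2_eq_square)
    then show "\<exists>d>0. \<forall>y. norm (y - t) < d \<longrightarrow>
        norm ((max 0 y)\<^sup>2 - (max 0 t)\<^sup>2 - 2 * max 0 t * (y - t)) \<le> e * norm (y - t)"
      using \<open>e > 0\<close> by blast
  qed (rule bounded_linear_mult_right)
  then show ?thesis unfolding has_field_derivative_def by (simp add: mult.commute[of _ "2 * max 0 t"])
qed

lemma bump_zero: "r \<ge> 0 \<Longrightarrow> r \<le> norm x \<Longrightarrow> bump r x = 0 \<and> bump_grad r x = 0"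
  by (simp add: bump_def bump_grad_def power2_norm_eq_inner[symmetric] power_mono)

lemma bump_nonneg: "bump r x \<ge> 0"
  by (simp add: bump_def)

lemma C1c_test_bump:
  assumes "r \<ge> 0"
  shows "C1c_test (bump r) (bump_grad r :: 'a::euclidean_space \<Rightarrow> 'a)"
  unfolding C1c_test_def
proof (intro conjI allI)
  fix x :: 'a
  have "((\<lambda>x. r\<^sup>2 - x \<bullet> x) has_derivative (\<lambda>h. - 2 * (x \<bullet> h))) (at x)"
    by (auto intro!: derivative_eq_intros simp: inner_commute)
  from has_derivative_compose[OF this DERIV_max_0_square[THEN has_field_derivative_imp_has_derivative]]
  show "(bump r has_derivative (\<lambda>h. bump_grad r x \<bullet> h)) (at x)"
    by (simp add: bump_def[abs_def] bump_grad_def mult.assoc mult.left_commute)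
  show "continuous_on UNIV (bump_grad r :: 'a \<Rightarrow> 'a)"
    unfolding bump_grad_def[abs_def] by (intro continuous_intros)
  have "norm x \<le> r" if "bump r x \<noteq> 0" for x :: 'a
    using bump_zero[OF assms, of x] that by force
  then have "bounded {x :: 'a. bump r x \<noteq> 0}" unfolding bounded_iff by blast
  then show "compact (closure {x :: 'a. bump r x \<noteq> 0})" by simp
qed

lemma bump_grad_le:
  fixes x :: "'a::euclidean_space"
  assumes "r \<ge> 0"
  shows "norm (bump_grad r x) \<le> 4 * r ^ 3 * indicator (cball 0 r) x"
proof (cases "norm x \<le> r")
  case True
  have "norm (bump_grad r x) = 4 * (max 0 (r\<^sup>2 - x \<bullet> x) * norm x)" by (simp add: bump_grad_def)
  also have "\<dots> \<le> 4 * (r\<^sup>2 * r)" using True by (intro mult_left_mono mult_mono) auto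
  finally show ?thesis using True by (simp add: power2_eq_square power3_eq_cube)
qed (use bump_zero[OF assms, of x] in auto)

text \<open>On the half ball r^2 - |x|^2 is at least 3 r^2 / 4; the weaker bound r^2 / 2 is what
  gets squared.\<close>

lemma bump_ge:
  fixes x :: "'a::euclidean_space"
  assumes "r \<ge> 0"
  shows "r ^ 4 / 4 * indicator (cball 0 (r / 2)) x \<le> bump r x"
proof (cases "norm x \<le> r / 2")
  case True
  then have "(norm x)\<^sup>2 \<le> (r / 2)\<^sup>2" by (intro power_mono) auto
  then have "r\<^sup>2 / 2 \<le> r\<^sup>2 - x \<bullet> x" using inner_ge_zero[of x] by (simp add: power2_norm_eq_inner power_divide del: inner_ge_zero)
  then have "r\<^sup>2 / 2 \<le> max 0 (r\<^sup>2 - x \<bullet> x)" by (rule max.coboundedI2)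
  then have "(r\<^sup>2 / 2)\<^sup>2 \<le> (max 0 (r\<^sup>2 - x \<bullet> x))\<^sup>2" by (intro power_mono) auto
  then show ?thesis using True by (simp add: bump_def power_divide)
qed (simp add: bump_nonneg)

lemma mollifier_kernel_exists:
  assumes "d > 0"
  shows "\<exists>\<rho> :: 'a::euclidean_space \<Rightarrow> real. mollifier_kernel d \<rho>"
proof -
  let ?b = "bump d :: 'a \<Rightarrow> real"
  have C: "C1c_test ?b (bump_grad d)" using assms by (intro C1c_test_bump) simp
  obtain B where B: "\<And>x. \<bar>?b x\<bar> \<le> B" by (blast intro: C1c_test_bounded[OF C])
  have ind: "integrable lborel (\<lambda>x::'a. indicat_real (cball 0 s) x)" for s
    by (intro integrable_real_indicator) (use emeasure_lborel_cball_finite in auto)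
  have m: "?b \<in> borel_measurable lborel"
    using C1c_test_continuous[OF C] borel_measurable_continuous_onI by auto
  have ib: "integrable lborel ?b"
  proof (rule Bochner_Integration.integrable_bound)
    show "integrable lborel (\<lambda>x::'a. B * indicat_real (cball 0 d) x)" using ind by simp
    have "\<bar>?b x\<bar> \<le> \<bar>B * indicat_real (cball 0 d) x\<bar>" for x
      using B[of x] bump_zero[of d x] assms by (cases "norm x \<le> d") auto
    then show "AE x in lborel. norm (?b x) \<le> norm (B * indicat_real (cball 0 d) x)" by simp
  qed (rule m)
  define I where "I = (\<integral>x. ?b x \<partial>lborel)"
  \<comment> \<open>The lower bound on the half ball makes the total mass positive, so dividing by
    it is legitimate.\<close>
  have "0 < d ^ 4 / 4 * measure lborel (cball (0::'a) (d / 2))" using assms by simp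
  also have "\<dots> = (\<integral>x. d ^ 4 / 4 * indicat_real (cball (0::'a) (d / 2)) x \<partial>lborel)" by simp
  also have "\<dots> \<le> I"
    unfolding I_def by (intro integral_mono integrable_mult_right ind ib bump_ge) (use assms in auto)
  finally have I: "I > 0" .
  have "C1c_test (\<lambda>x. ?b x / I) (\<lambda>x. bump_grad d x /\<^sub>R I)"
    using C I unfolding C1c_test_def
    by (auto intro!: derivative_eq_intros continuous_intros simp: divide_inverse mult.commute)
  then show ?thesis
    using I ib bump_zero[of d] assms unfolding mollifier_kernel_def
    by (intro exI[of _ "\<lambda>x. ?b x / I"]) (auto simp: bump_nonneg I_def[symmetric])
qed

subsection \<open>Nonlinear test functions\<close>


lemma loc_int_continuous:
  fixes h :: "'a::euclidean_space \<Rightarrow> real"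
  assumes h: "continuous_on UNIV h"
  shows "loc_int h"
  unfolding loc_int_def set_integrable_def
proof (intro conjI allI impI)
  show "h \<in> borel_measurable lebesgue" by (rule borel_measurable_lebesgue_continuous[OF h])
  fix K :: "'a set" assume K: "compact K"
  have i: "integrable lborel (\<lambda>x. indicat_real K x *\<^sub>R h x)"
    by (rule borel_integrable_compact[OF K continuous_on_subset[OF h]]) simp
  from this show "integrable lebesgue (\<lambda>x. indicat_real K x *\<^sub>R h x)"
    using borel_measurable_integrable[OF i] by (simp add: integrable_completion)
qed

lemma loc_int_diff: "loc_int h \<Longrightarrow> loc_int k \<Longrightarrow> loc_int (\<lambda>x. h x - k x)"
  unfolding loc_int_def by (auto intro: set_integral_diff)

lemma loc_int_add: "loc_int h \<Longrightarrow> loc_int k \<Longrightarrow> loc_int (\<lambda>x. h x + k x)"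
  unfolding loc_int_def by (auto intro: set_integral_add)

lemma loc_int_abs_integrable:
  assumes "loc_int h" "compact K"
  shows "integrable lebesgue (\<lambda>x. indicat_real K x * \<bar>h x\<bar>)"
proof -
  have "integrable lebesgue (\<lambda>x. \<bar>indicat_real K x *\<^sub>R h x\<bar>)"
    using assms by (intro integrable_abs) (simp add: loc_int_def set_integrable_def)
  then show ?thesis by (simp add: abs_mult)
qed

lemma mollify_L1_loc_tendsto:
  fixes h :: "'a::euclidean_space \<Rightarrow> real"
  assumes \<rho>: "\<And>n. mollifier_kernel (d n) (\<rho> n)" and d: "d \<longlonglongrightarrow> 0"
    and h: "loc_int h" and K: "compact K"
  shows "(\<lambda>n. \<integral>x. indicat_real K x * \<bar>mollify (\<rho> n) h x - h x\<bar> \<partial>lebesgue) \<longlonglongrightarrow> 0"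
proof (rule LIMSEQ_I)
  fix e :: real assume e: "e > 0"
  obtain \<delta> where \<delta>: "\<delta> > 0" "\<And>\<rho> d'. mollifier_kernel d' \<rho> \<Longrightarrow> d' \<le> \<delta> \<Longrightarrow>
    (\<integral>\<^sup>+x. ennreal (indicat_real K x * \<bar>mollify \<rho> h x - h x\<bar>) \<partial>lebesgue) \<le> ennreal (e / 2)"
    using mollify_L1_loc[OF h K, of "e / 2"] e by auto
  from order_tendstoD(2)[OF d \<delta>(1)] obtain N where N: "\<And>n. n \<ge> N \<Longrightarrow> d n < \<delta>"
    unfolding eventually_sequentially by blast
  have "norm ((\<integral>x. indicat_real K x * \<bar>mollify (\<rho> n) h x - h x\<bar> \<partial>lebesgue) - 0) < e" if "n \<ge> N" for n
  proof -
    obtain D where C: "C1c_test (\<rho> n) D" using \<rho>[of n] unfolding mollifier_kernel_def by blast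
    have i: "integrable lebesgue (\<lambda>x. indicat_real K x * \<bar>mollify (\<rho> n) h x - h x\<bar>)"
      by (intro loc_int_abs_integrable[OF _ K] loc_int_diff h loc_int_continuous mollify_continuous[OF C])
    have "ennreal (\<integral>x. indicat_real K x * \<bar>mollify (\<rho> n) h x - h x\<bar> \<partial>lebesgue) \<le> ennreal (e / 2)"
      using \<delta>(2)[OF \<rho>, of n] N[OF that] nn_integral_eq_integral[OF i] by simp
    then have "(\<integral>x. indicat_real K x * \<bar>mollify (\<rho> n) h x - h x\<bar> \<partial>lebesgue) \<le> e / 2"
      using e by (simp add: ennreal_le_iff)
    moreover have "(\<integral>x. indicat_real K x * \<bar>mollify (\<rho> n) h x - h x\<bar> \<partial>lebesgue) \<ge> 0"
      by (intro Bochner_Integration.integral_nonneg) simp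
    ultimately show ?thesis using e by simp
  qed
  then show "\<exists>N. \<forall>n\<ge>N. norm ((\<integral>x. indicat_real K x * \<bar>mollify (\<rho> n) h x - h x\<bar> \<partial>lebesgue) - 0) < e"
    by blast
qed

text \<open>Split c' m = c' (m - g) + c' g: the first integral is at most \<open>B\<close> times an
  L^1 distance that tends to 0, the second converges by dominated convergence. This is the limit
  passage for every term of the nonlinear test.\<close>

lemma tendsto_integral_bounded_mult_L1_loc:
  fixes g c :: "'a::euclidean_space \<Rightarrow> real"
  assumes K: "compact K" and g: "loc_int g" and m: "\<And>n. loc_int (m n)"
    and lim: "(\<lambda>n. \<integral>x. indicat_real K x * \<bar>m n x - g x\<bar> \<partial>lebesgue) \<longlonglongrightarrow> 0"
    and c: "\<And>n. c' n \<in> borel_measurable lebesgue" "c \<in> borel_measurable lebesgue"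
    and bound: "\<And>n x. \<bar>c' n x\<bar> \<le> B" and zero: "\<And>n x. x \<notin> K \<Longrightarrow> c' n x = 0"
    and ae: "AE x in lebesgue. (\<lambda>n. c' n x) \<longlonglongrightarrow> c x"
  shows "(\<lambda>n. \<integral>x. c' n x * m n x \<partial>lebesgue) \<longlonglongrightarrow> (\<integral>x. c x * g x \<partial>lebesgue)"
proof -
  have i: "integrable lebesgue (\<lambda>x. c' n x * h x)" if "loc_int h" for n h
    using loc_int_mult[OF that c(1) bound K zero] .
  have gm: "g \<in> borel_measurable lebesgue" using g by (simp add: loc_int_def)
  have 1: "(\<lambda>n. \<integral>x. c' n x * g x \<partial>lebesgue) \<longlonglongrightarrow> (\<integral>x. c x * g x \<partial>lebesgue)"
  proof (rule integral_dominated_convergence[where w = "\<lambda>x. B * (indicat_real K x * \<bar>g x\<bar>)"])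
    show "AE x in lebesgue. (\<lambda>n. c' n x * g x) \<longlonglongrightarrow> c x * g x"
      using ae by eventually_elim (intro tendsto_intros)
    show "AE x in lebesgue. norm (c' n x * g x) \<le> B * (indicat_real K x * \<bar>g x\<bar>)" for n
    proof (rule AE_I2)
      fix x
      show "norm (c' n x * g x) \<le> B * (indicat_real K x * \<bar>g x\<bar>)"
        using bound[of n x] zero[of x n] by (cases "x \<in> K") (auto simp: abs_mult mult_right_mono)
    qed
    show "integrable lebesgue (\<lambda>x. B * (indicat_real K x * \<bar>g x\<bar>))"
      using loc_int_abs_integrable[OF g K] by simp
  qed (use c gm in auto)
  have "(\<lambda>n. B * (\<integral>x. indicat_real K x * \<bar>m n x - g x\<bar> \<partial>lebesgue)) \<longlonglongrightarrow> 0"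
    using tendsto_mult_right_zero[OF lim] .
  then have 2: "(\<lambda>n. \<integral>x. c' n x * (m n x - g x) \<partial>lebesgue) \<longlonglongrightarrow> 0"
  proof (rule Lim_null_comparison[rotated], intro always_eventually allI)
    fix n
    have "norm (\<integral>x. c' n x * (m n x - g x) \<partial>lebesgue) \<le> (\<integral>x. norm (c' n x * (m n x - g x)) \<partial>lebesgue)"
      by (rule integral_norm_bound)
    also have "\<dots> \<le> (\<integral>x. B * (indicat_real K x * \<bar>m n x - g x\<bar>) \<partial>lebesgue)"
    proof (rule integral_mono)
      show "integrable lebesgue (\<lambda>x. norm (c' n x * (m n x - g x)))"
        by (intro integrable_norm i loc_int_diff m g)
      show "integrable lebesgue (\<lambda>x. B * (indicat_real K x * \<bar>m n x - g x\<bar>))"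
        using loc_int_abs_integrable[OF loc_int_diff[OF m g] K] by simp
      show "norm (c' n x * (m n x - g x)) \<le> B * (indicat_real K x * \<bar>m n x - g x\<bar>)" for x
        using bound[of n x] zero[of x n] by (cases "x \<in> K") (auto simp: abs_mult mult_right_mono)
    qed
    finally show "norm (\<integral>x. c' n x * (m n x - g x) \<partial>lebesgue)
       \<le> B * (\<integral>x. indicat_real K x * \<bar>m n x - g x\<bar> \<partial>lebesgue)" by simp
  qed
  have "(\<integral>x. c' n x * m n x \<partial>lebesgue) = (\<integral>x. c' n x * (m n x - g x) \<partial>lebesgue) + (\<integral>x. c' n x * g x \<partial>lebesgue)" for n
    using i[OF m, of n n] i[OF g, of n] by (simp add: right_diff_distrib)
  then show ?thesis using tendsto_add[OF 2 1] by simp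
qed

lemma C1c_test_nonlinear:
  assumes C: "C1c_test \<psi> D\<psi>"
    and \<gamma>: "\<And>s. (\<gamma> has_real_derivative \<gamma>' s) (at s)" and c\<gamma>: "continuous_on UNIV \<gamma>'"
    and W: "\<And>x. (W has_derivative (\<lambda>k. G x \<bullet> k)) (at x)" and G: "continuous_on UNIV G"
  shows "C1c_test (\<lambda>x. \<gamma> (W x) * \<psi> x) (\<lambda>x. (\<gamma>' (W x) * \<psi> x) *\<^sub>R G x + \<gamma> (W x) *\<^sub>R D\<psi> x)"
  unfolding C1c_test_def
proof (intro conjI allI)
  have cW: "continuous_on UNIV W"
    using has_derivative_continuous[OF W] by (auto intro!: continuous_at_imp_continuous_on)
  have c1: "continuous_on UNIV (\<lambda>x. \<gamma>' (W x))"
    using continuous_on_compose2[OF c\<gamma> cW] by simp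
  have "continuous_on UNIV \<gamma>"
    using DERIV_isCont[OF \<gamma>] by (auto intro!: continuous_at_imp_continuous_on)
  then have c2: "continuous_on UNIV (\<lambda>x. \<gamma> (W x))"
    using continuous_on_compose2[OF _ cW, of UNIV \<gamma>] by simp
  have D\<psi>: "continuous_on UNIV D\<psi>" using C unfolding C1c_test_def by auto
  show "continuous_on UNIV (\<lambda>x. (\<gamma>' (W x) * \<psi> x) *\<^sub>R G x + \<gamma> (W x) *\<^sub>R D\<psi> x)"
    by (intro continuous_on_add continuous_on_scaleR continuous_on_mult c1 c2 D\<psi> G C1c_test_continuous[OF C])
  have K: "compact (closure {x. \<psi> x \<noteq> 0})" using C unfolding C1c_test_def by auto
  show "compact (closure {x. \<gamma> (W x) * \<psi> x \<noteq> 0})"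
    using K by (auto simp: intro: bounded_subset[of "{x. \<psi> x \<noteq> 0}"])
  fix x
  have d1: "((\<lambda>x. \<gamma> (W x)) has_derivative (\<lambda>k. \<gamma>' (W x) * (G x \<bullet> k))) (at x)"
    using has_derivative_compose[OF W \<gamma>[THEN has_field_derivative_imp_has_derivative]] .
  have "(\<psi> has_derivative (\<lambda>k. D\<psi> x \<bullet> k)) (at x)" using C unfolding C1c_test_def by auto
  from has_derivative_mult[OF d1 this]
  show "((\<lambda>x. \<gamma> (W x) * \<psi> x) has_derivative (\<lambda>k. ((\<gamma>' (W x) * \<psi> x) *\<^sub>R G x + \<gamma> (W x) *\<^sub>R D\<psi> x) \<bullet> k)) (at x)"
    by (rule has_derivative_eq_rhs) (auto simp: fun_eq_iff inner_add_left algebra_simps)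
qed

text \<open>Formally this is the weak equation tested with \<gamma>(w) \<psi>, which is not C^1. The
  equation is used for \<gamma>(W) \<psi> with \<open>W\<close> a mollification of \<open>w\<close>,
  and the bounds on \<gamma> and \<gamma>' keep all coefficients bounded uniformly along the
  approximation.\<close>

lemma weak_eq_nonlinear_test:
  fixes F :: "'a::euclidean_space \<Rightarrow> 'a" and \<gamma> :: "real \<Rightarrow> real"
  assumes F: "F \<in> borel_measurable lebesgue" "\<And>x. norm (F x) \<le> M"
    and f: "loc_int f" and w: "loc_int w" and g: "weak_gradient w g"
    and gi: "\<And>i. i \<in> Basis \<Longrightarrow> loc_int (\<lambda>x. g x \<bullet> i)"
    and eq: "\<And>\<phi> D\<phi>. C1c_test \<phi> D\<phi> \<Longrightarrow> - (\<integral>x. F x \<bullet> D\<phi> x \<partial>lebesgue) = (\<integral>x. f x * \<phi> x \<partial>lebesgue)"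
    and \<gamma>: "\<And>s. (\<gamma> has_real_derivative \<gamma>' s) (at s)" and c\<gamma>: "continuous_on UNIV \<gamma>'"
    and A: "\<And>s. \<bar>\<gamma> s\<bar> \<le> A" "\<And>s. \<bar>\<gamma>' s\<bar> \<le> A"
    and C: "C1c_test \<psi> D\<psi>"
  shows "- ((\<integral>x. (\<gamma>' (w x) * \<psi> x) * (F x \<bullet> g x) \<partial>lebesgue)
      + (\<integral>x. \<gamma> (w x) * (F x \<bullet> D\<psi> x) \<partial>lebesgue)) = (\<integral>x. (\<gamma> (w x) * \<psi> x) * f x \<partial>lebesgue)"
proof -
  have "\<exists>\<rho>. \<forall>n. mollifier_kernel (1 / real (Suc n)) (\<rho> n :: 'a \<Rightarrow> real)"
    by (intro choice allI mollifier_kernel_exists) simp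
  then obtain \<rho>0 :: "nat \<Rightarrow> 'a \<Rightarrow> real" where \<rho>0: "\<And>n. mollifier_kernel (1 / real (Suc n)) (\<rho>0 n)" by blast
  have lim0: "(\<lambda>n. 1 / real (Suc n)) \<longlonglongrightarrow> 0" using LIMSEQ_Suc[OF lim_1_over_n] by simp
  obtain R where R: "R > 0" "\<And>x. R < norm x \<Longrightarrow> \<psi> x = 0 \<and> D\<psi> x = 0"
    using C1c_test_support_ball[OF C] by blast
  let ?K = "cball 0 R :: 'a set"
  have K: "compact ?K" by simp
  have zero: "\<psi> x = 0" "D\<psi> x = 0" if "x \<notin> ?K" for x using R(2)[of x] that by auto
  obtain B where B: "B > 0" "\<And>x. \<bar>\<psi> x\<bar> \<le> B" "\<And>x. norm (D\<psi> x) \<le> B"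
    by (blast intro: C1c_test_bounded[OF C])
  have cont0: "loc_int (mollify (\<rho>0 n) h)" if "loc_int h" for n h
    using \<rho>0[of n] mollify_continuous[OF _ that] loc_int_continuous
    unfolding mollifier_kernel_def by blast
  have iw: "integrable lebesgue (\<lambda>x. indicat_real ?K x * (mollify (\<rho>0 n) w x - w x))" for n
    using loc_int_diff[OF cont0[OF w] w, of n] K by (simp add: loc_int_def set_integrable_def)
  have "(\<lambda>n. \<integral>x. norm (indicat_real ?K x * (mollify (\<rho>0 n) w x - w x)) \<partial>lebesgue) \<longlonglongrightarrow> 0"
    using mollify_L1_loc_tendsto[OF \<rho>0 lim0 w K] by (simp add: abs_mult)
  \<comment> \<open>L^1 convergence gives almost everywhere convergence only along a subsequence;
    the L^1 limits for all other functions persist along it.\<close>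
  from tendsto_L1_AE_subseq[OF iw this] obtain r :: "nat \<Rightarrow> nat" where r: "strict_mono r"
    "AE x in lebesgue. (\<lambda>n. indicat_real ?K x * (mollify (\<rho>0 (r n)) w x - w x)) \<longlonglongrightarrow> 0"
    by blast
  define \<rho> where "\<rho> n = \<rho>0 (r n)" for n
  have L1: "(\<lambda>n. \<integral>x. indicat_real ?K x * \<bar>mollify (\<rho> n) h x - h x\<bar> \<partial>lebesgue) \<longlonglongrightarrow> 0" if "loc_int h" for h
    using LIMSEQ_subseq_LIMSEQ[OF mollify_L1_loc_tendsto[OF \<rho>0 lim0 that K] r(1)]
    by (simp add: o_def \<rho>_def)
  have C\<rho>: "\<exists>D. C1c_test (\<rho> n) D" for n using \<rho>0 unfolding \<rho>_def mollifier_kernel_def by blast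
  define W where "W n = mollify (\<rho> n) w" for n
  define m where "m i n = mollify (\<rho> n) (\<lambda>y. g y \<bullet> i)" for i n
  define G where "G n x = (\<Sum>i\<in>Basis. m i n x *\<^sub>R i)" for n x
  have Wl: "AE x in lebesgue. x \<in> ?K \<longrightarrow> (\<lambda>n. W n x) \<longlonglongrightarrow> w x"
    using r(2)
  proof eventually_elim
    case (elim x)
    show ?case
    proof
      assume "x \<in> ?K"
      then have "(\<lambda>n. W n x - w x) \<longlonglongrightarrow> 0" using elim by (simp add: W_def \<rho>_def)
      then show "(\<lambda>n. W n x) \<longlonglongrightarrow> w x" by (simp add: LIM_zero_iff)
    qed
  qed
  have dW: "(W n has_derivative (\<lambda>k. G n x \<bullet> k)) (at x)" for n x
    using C\<rho>[of n] mollify_gradient[OF _ w g] unfolding W_def G_def m_def by blast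
  have cm: "continuous_on UNIV (m i n)" if "i \<in> Basis" for i n
    using C\<rho>[of n] mollify_continuous[OF _ gi[OF that]] unfolding m_def by blast
  have cG: "continuous_on UNIV (G n)" for n
    unfolding G_def[abs_def] using cm by (intro continuous_on_sum continuous_on_scaleR continuous_on_const)
  have cW: "continuous_on UNIV (W n)" for n
    using has_derivative_continuous[OF dW] by (auto intro!: continuous_at_imp_continuous_on)
  have cg: "continuous_on UNIV \<gamma>"
    using DERIV_isCont[OF \<gamma>] by (auto intro!: continuous_at_imp_continuous_on)
  have tl: "(\<lambda>n. \<gamma> (W n x)) \<longlonglongrightarrow> \<gamma> (w x)" "(\<lambda>n. \<gamma>' (W n x)) \<longlonglongrightarrow> \<gamma>' (w x)"
    if "(\<lambda>n. W n x) \<longlonglongrightarrow> w x" for x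
    using continuous_on_tendsto_compose[OF cg that] continuous_on_tendsto_compose[OF c\<gamma> that] by auto
  have bm: "\<gamma> \<in> borel_measurable borel" "\<gamma>' \<in> borel_measurable borel"
    using cg c\<gamma> borel_measurable_continuous_onI by auto
  have wm: "w \<in> borel_measurable lebesgue" using w by (simp add: loc_int_def)
  have Wm: "W n \<in> borel_measurable lebesgue" for n by (rule borel_measurable_lebesgue_continuous[OF cW])
  have \<psi>m: "\<psi> \<in> borel_measurable lebesgue"
    by (rule borel_measurable_lebesgue_continuous[OF C1c_test_continuous[OF C]])
  have D\<psi>m: "D\<psi> \<in> borel_measurable lebesgue"
    using C unfolding C1c_test_def by (intro borel_measurable_lebesgue_continuous) auto
  have mm: "(\<lambda>x. \<gamma> (w x)) \<in> borel_measurable lebesgue" "(\<lambda>x. \<gamma>' (w x)) \<in> borel_measurable lebesgue"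
    "(\<lambda>x. \<gamma> (W n x)) \<in> borel_measurable lebesgue" "(\<lambda>x. \<gamma>' (W n x)) \<in> borel_measurable lebesgue" for n
    using measurable_compose[OF wm bm(1)] measurable_compose[OF wm bm(2)]
      measurable_compose[OF Wm bm(1)] measurable_compose[OF Wm bm(2)] by auto
  \<comment> \<open>The term containing the gradient of the cutoff has only bounded factors; it fits
    the limit lemma with the constant 1 as its L^1_loc factor.\<close>
  have one: "loc_int (\<lambda>x::'a. 1)" by (rule loc_int_continuous) simp
  have A0: "A \<ge> 0" using A(1)[of 0] by linarith
  have M0: "M \<ge> 0" using F(2)[of 0] norm_ge_zero order_trans by blast
  have Fi: "\<bar>F x \<bullet> i\<bar> \<le> M" if "i \<in> Basis" for x i
    using Basis_le_norm[OF that, of "F x"] F(2)[of x] by linarith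
  have FD: "\<bar>F x \<bullet> D\<psi> x\<bar> \<le> M * B" for x
    using Cauchy_Schwarz_ineq2[of "F x" "D\<psi> x"] mult_mono[OF F(2)[of x] B(3)[of x] M0] by simp
  have bi: "\<bar>\<gamma>' s * \<psi> x * (F x \<bullet> i)\<bar> \<le> A * B * M" if "i \<in> Basis" for i x s
    unfolding abs_mult using A(2) B Fi[OF that] A0 by (intro mult_mono) auto
  have b1: "\<bar>\<gamma> s * (F x \<bullet> D\<psi> x)\<bar> \<le> A * (M * B)" for x s
    unfolding abs_mult using A(1) FD A0 by (intro mult_mono) auto
  have b2: "\<bar>\<gamma> s * \<psi> x\<bar> \<le> A * B" for x s
    unfolding abs_mult using A(1) B A0 by (intro mult_mono) auto
  have limi: "(\<lambda>n. \<integral>x. (\<gamma>' (W n x) * \<psi> x * (F x \<bullet> i)) * m i n x \<partial>lebesgue)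
     \<longlonglongrightarrow> (\<integral>x. (\<gamma>' (w x) * \<psi> x * (F x \<bullet> i)) * (g x \<bullet> i) \<partial>lebesgue)" if i: "i \<in> Basis" for i
  proof (rule tendsto_integral_bounded_mult_L1_loc[OF K gi[OF i]])
    show "loc_int (m i n)" for n by (rule loc_int_continuous[OF cm[OF i]])
    show "(\<lambda>n. \<integral>x. indicat_real ?K x * \<bar>m i n x - g x \<bullet> i\<bar> \<partial>lebesgue) \<longlonglongrightarrow> 0"
      unfolding m_def by (rule L1[OF gi[OF i]])
    show "AE x in lebesgue. (\<lambda>n. \<gamma>' (W n x) * \<psi> x * (F x \<bullet> i)) \<longlonglongrightarrow> \<gamma>' (w x) * \<psi> x * (F x \<bullet> i)"
      using Wl
    proof eventually_elim
      case (elim x)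
      then show ?case by (cases "x \<in> ?K") (auto simp: zero intro!: tendsto_intros tl)
    qed
  qed (use mm \<psi>m F(1) bi[OF i] zero in auto)
  have lim1: "(\<lambda>n. \<integral>x. (\<gamma> (W n x) * (F x \<bullet> D\<psi> x)) * 1 \<partial>lebesgue)
     \<longlonglongrightarrow> (\<integral>x. (\<gamma> (w x) * (F x \<bullet> D\<psi> x)) * 1 \<partial>lebesgue)"
  proof (rule tendsto_integral_bounded_mult_L1_loc[OF K one one])
    show "AE x in lebesgue. (\<lambda>n. \<gamma> (W n x) * (F x \<bullet> D\<psi> x)) \<longlonglongrightarrow> \<gamma> (w x) * (F x \<bullet> D\<psi> x)"
      using Wl
    proof eventually_elim
      case (elim x)
      then show ?case by (cases "x \<in> ?K") (auto simp: zero intro!: tendsto_intros tl)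
    qed
  qed (use mm D\<psi>m F(1) b1 zero in auto)
  have lim2: "(\<lambda>n. \<integral>x. (\<gamma> (W n x) * \<psi> x) * f x \<partial>lebesgue)
     \<longlonglongrightarrow> (\<integral>x. (\<gamma> (w x) * \<psi> x) * f x \<partial>lebesgue)"
  proof (rule tendsto_integral_bounded_mult_L1_loc[OF K f f])
    show "AE x in lebesgue. (\<lambda>n. \<gamma> (W n x) * \<psi> x) \<longlonglongrightarrow> \<gamma> (w x) * \<psi> x"
      using Wl
    proof eventually_elim
      case (elim x)
      then show ?case by (cases "x \<in> ?K") (auto simp: zero intro!: tendsto_intros tl)
    qed
  qed (use mm \<psi>m b2 zero in auto)
  \<comment> \<open>The inner product with the mollified gradient is split into coordinates, so that
    each summand is a bounded coefficient times one scalar mollification.\<close>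
  have eqn: "- ((\<Sum>i\<in>Basis. \<integral>x. (\<gamma>' (W n x) * \<psi> x * (F x \<bullet> i)) * m i n x \<partial>lebesgue)
      + (\<integral>x. (\<gamma> (W n x) * (F x \<bullet> D\<psi> x)) * 1 \<partial>lebesgue)) = (\<integral>x. (\<gamma> (W n x) * \<psi> x) * f x \<partial>lebesgue)" for n
  proof -
    have i1: "integrable lebesgue (\<lambda>x. (\<gamma>' (W n x) * \<psi> x * (F x \<bullet> i)) * m i n x)" if i: "i \<in> Basis" for i
      by (rule loc_int_mult[OF loc_int_continuous[OF cm[OF i]] _ bi[OF i] K])
        (use mm \<psi>m F(1) zero in auto)
    have i2: "integrable lebesgue (\<lambda>x. (\<gamma> (W n x) * (F x \<bullet> D\<psi> x)) * 1)"
      by (rule loc_int_mult[OF one _ b1 K]) (use mm D\<psi>m F(1) zero in auto)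
    have FG: "F x \<bullet> G n x = (\<Sum>i\<in>Basis. (F x \<bullet> i) * m i n x)" for x
      by (simp add: G_def inner_sum_right mult.commute)
    have "(\<integral>x. F x \<bullet> ((\<gamma>' (W n x) * \<psi> x) *\<^sub>R G n x + \<gamma> (W n x) *\<^sub>R D\<psi> x) \<partial>lebesgue)
      = (\<integral>x. (\<Sum>i\<in>Basis. (\<gamma>' (W n x) * \<psi> x * (F x \<bullet> i)) * m i n x) + (\<gamma> (W n x) * (F x \<bullet> D\<psi> x)) * 1 \<partial>lebesgue)"
      by (intro Bochner_Integration.integral_cong refl)
        (simp add: inner_add_right FG sum_distrib_left mult.assoc)
    also have "\<dots> = (\<Sum>i\<in>Basis. \<integral>x. (\<gamma>' (W n x) * \<psi> x * (F x \<bullet> i)) * m i n x \<partial>lebesgue)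
      + (\<integral>x. (\<gamma> (W n x) * (F x \<bullet> D\<psi> x)) * 1 \<partial>lebesgue)"
      using i1 i2 by (subst Bochner_Integration.integral_add) (auto intro!: Bochner_Integration.integral_sum)
    finally show ?thesis
      using eq[OF C1c_test_nonlinear[OF C \<gamma> c\<gamma> dW cG, of n]] by (simp add: mult.commute)
  qed
  have "(\<lambda>n. - ((\<Sum>i\<in>Basis. \<integral>x. (\<gamma>' (W n x) * \<psi> x * (F x \<bullet> i)) * m i n x \<partial>lebesgue)
      + (\<integral>x. (\<gamma> (W n x) * (F x \<bullet> D\<psi> x)) * 1 \<partial>lebesgue)))
    \<longlonglongrightarrow> - ((\<Sum>i\<in>Basis. \<integral>x. (\<gamma>' (w x) * \<psi> x * (F x \<bullet> i)) * (g x \<bullet> i) \<partial>lebesgue)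
      + (\<integral>x. (\<gamma> (w x) * (F x \<bullet> D\<psi> x)) * 1 \<partial>lebesgue))"
    by (intro tendsto_minus tendsto_add tendsto_sum limi lim1)
  \<comment> \<open>By \<open>eqn\<close> the two sides are the same sequence, so their limits
    agree.\<close>
  from LIMSEQ_unique[OF this] lim2
  have eq0: "- ((\<Sum>i\<in>Basis. \<integral>x. (\<gamma>' (w x) * \<psi> x * (F x \<bullet> i)) * (g x \<bullet> i) \<partial>lebesgue)
      + (\<integral>x. \<gamma> (w x) * (F x \<bullet> D\<psi> x) \<partial>lebesgue)) = (\<integral>x. (\<gamma> (w x) * \<psi> x) * f x \<partial>lebesgue)"
    unfolding eqn by simp
  have "integrable lebesgue (\<lambda>x. (\<gamma>' (w x) * \<psi> x * (F x \<bullet> i)) * (g x \<bullet> i))" if i: "i \<in> Basis" for i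
    by (rule loc_int_mult[OF gi[OF i] _ bi[OF i] K]) (use mm \<psi>m F(1) zero in auto)
  then have "(\<Sum>i\<in>Basis. \<integral>x. (\<gamma>' (w x) * \<psi> x * (F x \<bullet> i)) * (g x \<bullet> i) \<partial>lebesgue)
    = (\<integral>x. (\<Sum>i\<in>Basis. (\<gamma>' (w x) * \<psi> x * (F x \<bullet> i)) * (g x \<bullet> i)) \<partial>lebesgue)"
    by (rule Bochner_Integration.integral_sum[symmetric])
  also have "\<dots> = (\<integral>x. (\<gamma>' (w x) * \<psi> x) * (F x \<bullet> g x) \<partial>lebesgue)"
    by (intro Bochner_Integration.integral_cong refl)
      (simp add: euclidean_inner[of "F _" "g _"] sum_distrib_left mult.assoc)
  finally show ?thesis using eq0 by simp
qed

subsection \<open>The energy estimate\<close>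


lemma abs_arctan_le_abs: "\<bar>arctan x\<bar> \<le> \<bar>x :: real\<bar>"
proof -
  have "norm (arctan x - arctan 0) \<le> 1 * norm (x - 0)"
    by (rule field_differentiable_bound[of UNIV arctan "\<lambda>x. inverse (1 + x\<^sup>2)"])
      (auto intro: DERIV_arctan has_field_derivative_at_within simp: inverse_le_1_iff add_pos_nonneg)
  then show ?thesis by simp
qed

lemma abs_arctan_le_2: "\<bar>arctan x\<bar> \<le> 2"
  using arctan_bounded[of x] pi_less_4 by (simp add: abs_le_iff)

text \<open>Quantitative form of the statement that the sum of the two nonlinearities has the sign
  of a + b: the larger of the two numbers is at least the mean, and the other one either helps or
  can be absorbed.\<close>

lemma odd_power_sum_ge:
  fixes a b q :: real
  assumes q: "q > 1" and pos: "a + b > 0"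
  shows "((a + b) / 2) powr q \<le> \<bar>a\<bar> powr (q - 1) * a + \<bar>b\<bar> powr (q - 1) * b"
proof -
  have main: "((a + b) / 2) powr q \<le> \<bar>a\<bar> powr (q - 1) * a + \<bar>b\<bar> powr (q - 1) * b"
    if pos: "a + b > 0" and le: "b \<le> a" for a b :: real
  proof -
    let ?h = "(a + b) / 2"
    have h: "0 < ?h" "?h \<le> a" using pos le by auto
    have mono: "?h powr (q - 1) \<le> a powr (q - 1)"
      using h q by (intro powr_mono2) auto
    have split: "?h powr q = ?h powr (q - 1) * ?h"
      using h powr_add[of ?h "q - 1" 1] by simp
    show ?thesis
    proof (cases "b \<ge> 0")
      case True
      have "?h powr (q - 1) * ?h \<le> a powr (q - 1) * a" using mono h by (intro mult_mono) auto
      moreover have "0 \<le> \<bar>b\<bar> powr (q - 1) * b" using True by simp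
      ultimately show ?thesis using split h by simp
    next
      case False
      \<comment> \<open>A negative b satisfies |b| < a because a + b > 0; replacing |b| by a in the
        weight bounds the sum below by a^(q-1) (a + b).\<close>
      have "\<bar>b\<bar> powr (q - 1) \<le> a powr (q - 1)"
        using False pos q by (intro powr_mono2) auto
      then have "a powr (q - 1) * b \<le> \<bar>b\<bar> powr (q - 1) * b"
        using False by (intro mult_right_mono_neg) auto
      moreover have "?h powr (q - 1) * ?h \<le> a powr (q - 1) * (a + b)"
        using mono h pos by (intro mult_mono) auto
      ultimately show ?thesis using split h by (simp add: distrib_left)
    qed
  qed
  show ?thesis
    using main[of a b] main[of b a] pos by (cases "b \<le> a") (auto simp: add.commute)
qed

text \<open>With t = arctan(a + b) > 0 one has t \<le> a + b and t/2 \<le> 1; the latter allows the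
  real exponent q to be raised to the integer Q. The factor (1/2)^Q stems from the mean in
  \<open>odd_power_sum_ge\<close>. Negative sums reduce to positive ones by oddness.\<close>

lemma odd_power_sum_arctan_ge:
  fixes a b q :: real
  assumes q: "q > 1" "q \<le> real Q" and m: "odd m"
  shows "(1 / 2) ^ Q * \<bar>arctan (a + b)\<bar> ^ (Q + m)
    \<le> arctan (a + b) ^ m * (\<bar>a\<bar> powr (q - 1) * a + \<bar>b\<bar> powr (q - 1) * b)"
proof -
  have main: "(1 / 2) ^ Q * \<bar>arctan (a + b)\<bar> ^ (Q + m)
    \<le> arctan (a + b) ^ m * (\<bar>a\<bar> powr (q - 1) * a + \<bar>b\<bar> powr (q - 1) * b)"
    if pos: "a + b > 0" for a b :: real
  proof -
    define t where "t = arctan (a + b)"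
    have t: "0 < t" "t \<le> a + b" "t \<le> 2"
      using pos abs_arctan_le_abs[of "a + b"] abs_arctan_le_2[of "a + b"] by (auto simp: t_def)
    have "(t / 2) ^ Q = (t / 2) powr real Q" using t by (simp add: powr_realpow)
    also have "\<dots> \<le> (t / 2) powr q" using t q by (intro powr_mono') auto
    also have "\<dots> \<le> ((a + b) / 2) powr q" using t q by (intro powr_mono2) auto
    also have "\<dots> \<le> \<bar>a\<bar> powr (q - 1) * a + \<bar>b\<bar> powr (q - 1) * b"
      by (rule odd_power_sum_ge[OF q(1) pos])
    finally have "t ^ m * (t / 2) ^ Q \<le> t ^ m * (\<bar>a\<bar> powr (q - 1) * a + \<bar>b\<bar> powr (q - 1) * b)"
      using t by (intro mult_left_mono) auto
    moreover have "t ^ m * (t / 2) ^ Q = (1 / 2) ^ Q * \<bar>t\<bar> ^ (Q + m)"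
      using t by (simp add: power_add power_divide)
    ultimately show ?thesis unfolding t_def by simp
  qed
  consider "a + b > 0" | "a + b = 0" | "a + b < 0" by linarith
  then show ?thesis
  proof cases
    case 2
    \<comment> \<open>Oddness excludes m = 0, so both powers of 0 vanish.\<close>
    then show ?thesis using m by (cases m) auto
  next
    case 3
    have "- a + - b = - (a + b)" by simp
    then show ?thesis using main[of "- a" "- b"] 3 m
      by (simp only: arctan_minus abs_minus_cancel power_minus_odd mult_minus_right mult_minus_left) (simp add: algebra_simps)
  qed (rule main)
qed

section \<open>Boundedness, oddness and monotonicity of the mean curvature flux\<close>

lemma norm_mc_flux_le: "norm (mc_flux z) \<le> 1"
proof -
  have "norm z \<le> sqrt (1 + (norm z)\<^sup>2)" by (rule real_le_rsqrt) simp
  moreover have "sqrt (1 + (norm z)\<^sup>2) > 0" by (simp add: add_pos_nonneg)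
  ultimately show ?thesis by (simp add: mc_flux_def field_simps)
qed

lemma mc_flux_minus: "mc_flux (- z) = - mc_flux z"
  by (simp add: mc_flux_def)

text \<open>After expansion, Cauchy-Schwarz on the mixed term reduces the claim to the lengths x and
  y of the vectors, where it is monotonicity of s / sqrt(1 + s^2).\<close>

lemma mc_flux_monotone:
  fixes a c :: "'a::euclidean_space"
  shows "0 \<le> (mc_flux a - mc_flux c) \<bullet> (a - c)"
proof -
  define x y where "x = norm a" and "y = norm c"
  define s t where "s = sqrt (1 + x\<^sup>2)" and "t = sqrt (1 + y\<^sup>2)"
  have st: "s > 0" "t > 0" unfolding s_def t_def by (simp_all add: add_pos_nonneg)
  have xy: "x \<ge> 0" "y \<ge> 0" by (simp_all add: x_def y_def)
  have mono: "y' / sqrt (1 + y'\<^sup>2) \<le> x' / sqrt (1 + x'\<^sup>2)" if "0 \<le> y'" "y' \<le> x'" for x' y' :: real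
  proof -
    have "y'\<^sup>2 \<le> x'\<^sup>2" using that by (intro power_mono)
    then have "sqrt (y'\<^sup>2 * (1 + x'\<^sup>2)) \<le> sqrt (x'\<^sup>2 * (1 + y'\<^sup>2))"
      by (intro real_sqrt_le_mono) (simp add: algebra_simps)
    then have "y' * sqrt (1 + x'\<^sup>2) \<le> x' * sqrt (1 + y'\<^sup>2)"
      using that by (simp add: real_sqrt_mult)
    moreover have "sqrt (1 + x'\<^sup>2) > 0" "sqrt (1 + y'\<^sup>2) > 0" by (simp_all add: add_pos_nonneg)
    ultimately show ?thesis by (simp add: field_simps)
  qed
  have "0 \<le> (x / s - y / t) * (x - y)"
  proof (cases "y \<le> x")
    case True
    then show ?thesis using mono[OF xy(2) True] by (simp add: s_def t_def)
  next
    case False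
    then show ?thesis using mono[of x y] xy by (intro mult_nonpos_nonpos) (simp_all add: s_def t_def)
  qed
  also have "\<dots> = x\<^sup>2 / s + y\<^sup>2 / t - x * y * (1 / s + 1 / t)"
    using st by (simp add: field_simps power2_eq_square)
  also have "\<dots> \<le> x\<^sup>2 / s + y\<^sup>2 / t - (a \<bullet> c) * (1 / s + 1 / t)"
    using st norm_cauchy_schwarz[of a c] by (intro diff_mono mult_right_mono) (auto simp: x_def y_def)
  also have "\<dots> = (mc_flux a - mc_flux c) \<bullet> (a - c)"
    using st unfolding mc_flux_def x_def[symmetric] y_def[symmetric] s_def[symmetric] t_def[symmetric]
    by (simp add: inner_diff_left inner_diff_right power2_norm_eq_inner[symmetric] x_def y_def inner_commute field_simps)
  finally show ?thesis .
qed

lemma mc_flux_measurable [measurable]: "mc_flux \<in> borel_measurable (borel :: 'a::euclidean_space measure)"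
proof (rule borel_measurable_continuous_onI)
  have "sqrt (1 + (norm z)\<^sup>2) \<noteq> 0" for z :: 'a
    by (metis add_pos_nonneg less_irrefl real_sqrt_gt_zero zero_le_power2 zero_less_one)
  then show "continuous_on UNIV (mc_flux :: 'a \<Rightarrow> 'a)"
    unfolding mc_flux_def[abs_def] by (intro continuous_intros) auto
qed

section \<open>Testing with a power of the arctangent\<close>

text \<open>The term with F \<bullet> g has a favourable sign and is discarded, so the gradient of
  \<open>w\<close> disappears from the estimate; the remaining flux term is controlled by |F| \<le>
  2 and the gradient of the cutoff.\<close>

lemma arctan_energy_step:
  fixes F :: "'a::euclidean_space \<Rightarrow> 'a"
  assumes F: "F \<in> borel_measurable lebesgue" "\<And>x. norm (F x) \<le> 2"
    and f: "loc_int f" and w: "loc_int w" and g: "weak_gradient w g"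
    and gi: "\<And>i. i \<in> Basis \<Longrightarrow> loc_int (\<lambda>x. g x \<bullet> i)"
    and eq: "\<And>\<phi> D\<phi>. C1c_test \<phi> D\<phi> \<Longrightarrow> - (\<integral>x. F x \<bullet> D\<phi> x \<partial>lebesgue) = (\<integral>x. f x * \<phi> x \<partial>lebesgue)"
    and Fg: "\<And>x. 0 \<le> F x \<bullet> g x" and m: "odd m" and c: "c \<ge> 0"
    and fw: "\<And>x. c * \<bar>arctan (w x)\<bar> ^ (Q + m) \<le> arctan (w x) ^ m * f x"
    and r: "r > 0"
  shows "c * r * (\<integral>x. indicat_real (cball 0 (r / 2)) x * \<bar>arctan (w x)\<bar> ^ (Q + m) \<partial>lebesgue)
    \<le> 32 * (\<integral>x. indicat_real (cball 0 r) x * \<bar>arctan (w x)\<bar> ^ m \<partial>lebesgue)"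
proof -
  let ?t = "\<lambda>x. \<bar>arctan (w x)\<bar>" and ?\<psi> = "bump r :: 'a \<Rightarrow> real" and ?D = "bump_grad r :: 'a \<Rightarrow> 'a"
  define \<gamma> where "\<gamma> s = arctan s ^ m" for s :: real
  define \<gamma>' where "\<gamma>' s = real m * arctan s ^ (m - 1) * inverse (1 + s\<^sup>2)" for s :: real
  have C: "C1c_test ?\<psi> ?D" using r by (intro C1c_test_bump) simp
  have d\<gamma>: "(\<gamma> has_real_derivative \<gamma>' s) (at s)" for s
    unfolding \<gamma>_def[abs_def] \<gamma>'_def by (auto intro!: derivative_eq_intros simp: field_simps)
  have nz: "1 + s\<^sup>2 \<noteq> 0" for s :: real by (metis add_pos_nonneg less_irrefl zero_le_power2 zero_less_one)
  have c\<gamma>: "continuous_on UNIV \<gamma>'"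
    unfolding \<gamma>'_def[abs_def] using nz by (intro continuous_intros) auto
  \<comment> \<open>Here m - 1 is even because m is odd.\<close>
  have \<gamma>'_nn: "\<gamma>' s \<ge> 0" for s
    unfolding \<gamma>'_def using m by (intro mult_nonneg_nonneg zero_le_even_power) auto
  \<comment> \<open>Both entries come from |arctan| \<le> 2; the factor 1 / (1 + s^2) is at most
    1.\<close>
  define A where "A = max (2 ^ m) (real m * 2 ^ (m - 1))"
  have A1: "\<bar>\<gamma> s\<bar> \<le> A" for s
    unfolding \<gamma>_def A_def power_abs by (intro max.coboundedI1 power_mono abs_arctan_le_2) simp
  have A2: "\<bar>\<gamma>' s\<bar> \<le> A" for s
  proof -
    have "\<bar>\<gamma>' s\<bar> = real m * \<bar>arctan s\<bar> ^ (m - 1) * inverse (1 + s\<^sup>2)"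
      unfolding \<gamma>'_def by (simp add: abs_mult power_abs)
    also have "\<dots> \<le> real m * 2 ^ (m - 1) * 1"
      using abs_arctan_le_2[of s]
      by (intro mult_mono power_mono) (auto simp: inverse_le_1_iff add_pos_nonneg)
    finally show ?thesis unfolding A_def by simp
  qed
  have wm: "w \<in> borel_measurable lebesgue" using w by (simp add: loc_int_def)
  have am: "(\<lambda>x. arctan (w x)) \<in> borel_measurable lebesgue" 
    using wm borel_measurable_arctan by (rule measurable_compose)
  then have tm: "?t \<in> borel_measurable lebesgue" by (rule borel_measurable_abs)
  have \<gamma>m: "(\<lambda>x. \<gamma> (w x)) \<in> borel_measurable lebesgue" 
    unfolding \<gamma>_def using am by (rule borel_measurable_power)
  have \<psi>m: "?\<psi> \<in> borel_measurable lebesgue"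
    by (rule borel_measurable_lebesgue_continuous[OF C1c_test_continuous[OF C]])
  have Dm: "?D \<in> borel_measurable lebesgue"
    using C unfolding C1c_test_def by (intro borel_measurable_lebesgue_continuous) auto
  have one: "loc_int (\<lambda>x::'a. 1)" by (rule loc_int_continuous) simp
  have it: "integrable lebesgue (\<lambda>x. indicat_real (cball 0 s) x * ?t x ^ k)" for s k
  proof -
    have "integrable lebesgue (\<lambda>x. (indicat_real (cball 0 s) x * ?t x ^ k) * 1)"
    proof (rule loc_int_mult[OF one, where K = "cball 0 s" and B = "2 ^ k"])
      show "(\<lambda>x. indicat_real (cball 0 s) x * ?t x ^ k) \<in> borel_measurable lebesgue"
        using tm borel_measurable_indicator[of "cball 0 s" lebesgue]
        by (intro borel_measurable_times borel_measurable_power) auto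
      show "\<bar>indicat_real (cball 0 s) x * ?t x ^ k\<bar> \<le> 2 ^ k" for x
        using power_mono[OF abs_arctan_le_2[of "w x"], of k] by (auto simp: abs_mult split: split_indicator)
    qed auto
    then show ?thesis by simp
  qed
  have zero: "?\<psi> x = 0" "?D x = 0" if "x \<notin> cball 0 r" for x
    using bump_zero[of r x] that r by auto
  obtain B where B: "B > 0" "\<And>x. \<bar>?\<psi> x\<bar> \<le> B" "\<And>x. norm (?D x) \<le> B"
    by (blast intro: C1c_test_bounded[OF C])
  have i\<psi>: "integrable lebesgue (\<lambda>x. (\<gamma> (w x) * ?\<psi> x) * f x)"
  proof (rule loc_int_mult[OF f, where K = "cball 0 r" and B = "A * B"])
    show "\<bar>\<gamma> (w x) * ?\<psi> x\<bar> \<le> A * B" for x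
      unfolding abs_mult using A1[of "w x"] B(2)[of x] by (intro mult_mono) auto
  qed (use \<gamma>m \<psi>m zero in auto)
  have FD: "\<bar>\<gamma> (w x) * (F x \<bullet> ?D x)\<bar> \<le> 8 * r ^ 3 * (indicat_real (cball 0 r) x * ?t x ^ m)" for x
  proof -
    have "\<bar>F x \<bullet> ?D x\<bar> \<le> norm (F x) * norm (?D x)" by (rule Cauchy_Schwarz_ineq2)
    also have "\<dots> \<le> 2 * (4 * r ^ 3 * indicator (cball 0 r) x)"
      using F(2) bump_grad_le[of r x] r by (intro mult_mono) auto
    finally have "\<bar>\<gamma> (w x)\<bar> * \<bar>F x \<bullet> ?D x\<bar> \<le> ?t x ^ m * (2 * (4 * r ^ 3 * indicator (cball 0 r) x))"
      unfolding \<gamma>_def power_abs by (intro mult_left_mono) auto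
    then show ?thesis by (simp add: abs_mult algebra_simps)
  qed
  have "c * r ^ 4 / 4 * (\<integral>x. indicat_real (cball 0 (r / 2)) x * ?t x ^ (Q + m) \<partial>lebesgue)
      = (\<integral>x. c * r ^ 4 / 4 * (indicat_real (cball 0 (r / 2)) x * ?t x ^ (Q + m)) \<partial>lebesgue)"
    by simp
  also have "\<dots> \<le> (\<integral>x. (\<gamma> (w x) * ?\<psi> x) * f x \<partial>lebesgue)"
  proof (rule integral_mono)
    fix x
    have "c * r ^ 4 / 4 * (indicat_real (cball 0 (r / 2)) x * ?t x ^ (Q + m))
      = (r ^ 4 / 4 * indicat_real (cball 0 (r / 2)) x) * (c * ?t x ^ (Q + m))" by simp
    also have "\<dots> \<le> ?\<psi> x * (\<gamma> (w x) * f x)"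
      using bump_ge[of r x] fw[of x] r c bump_nonneg[of r x] unfolding \<gamma>_def
      by (intro mult_mono[of _ _ "c * _"]) auto
    finally show "c * r ^ 4 / 4 * (indicat_real (cball 0 (r / 2)) x * ?t x ^ (Q + m))
      \<le> (\<gamma> (w x) * ?\<psi> x) * f x" by (simp add: algebra_simps)
  qed (use it i\<psi> in auto)
  also have "\<dots> = - (\<integral>x. (\<gamma>' (w x) * ?\<psi> x) * (F x \<bullet> g x) \<partial>lebesgue)
      - (\<integral>x. \<gamma> (w x) * (F x \<bullet> ?D x) \<partial>lebesgue)"
    using weak_eq_nonlinear_test[OF F f w g gi eq d\<gamma> c\<gamma> A1 A2 C] by simp
  \<comment> \<open>Monotonicity of the flux enters here, through \<open>Fg\<close>.\<close>
  also have "\<dots> \<le> - (\<integral>x. \<gamma> (w x) * (F x \<bullet> ?D x) \<partial>lebesgue)"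
  proof -
    have "0 \<le> (\<integral>x. (\<gamma>' (w x) * ?\<psi> x) * (F x \<bullet> g x) \<partial>lebesgue)"
      by (intro Bochner_Integration.integral_nonneg mult_nonneg_nonneg \<gamma>'_nn bump_nonneg Fg)
    then show ?thesis by simp
  qed
  also have "\<dots> \<le> norm (\<integral>x. \<gamma> (w x) * (F x \<bullet> ?D x) \<partial>lebesgue)" by simp
  also have "\<dots> \<le> (\<integral>x. 8 * r ^ 3 * (indicat_real (cball 0 r) x * ?t x ^ m) \<partial>lebesgue)"
  proof (rule order_trans[OF integral_norm_bound integral_mono])
    have i8: "integrable lebesgue (\<lambda>x. 8 * r ^ 3 * (indicat_real (cball 0 r) x * ?t x ^ m))"
      using it[of r m] by simp
    then show "integrable lebesgue (\<lambda>x. norm (\<gamma> (w x) * (F x \<bullet> ?D x)))"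
    proof (rule integrable_norm[OF Bochner_Integration.integrable_bound])
      show "(\<lambda>x. \<gamma> (w x) * (F x \<bullet> ?D x)) \<in> borel_measurable lebesgue"
        using \<gamma>m F(1) Dm by simp
      show "AE x in lebesgue. norm (\<gamma> (w x) * (F x \<bullet> ?D x))
        \<le> norm (8 * r ^ 3 * (indicat_real (cball 0 r) x * ?t x ^ m))"
        by (intro AE_I2) (simp only: real_norm_def order_trans[OF FD abs_ge_self])
    qed
    show "norm (\<gamma> (w x) * (F x \<bullet> ?D x)) \<le> 8 * r ^ 3 * (indicat_real (cball 0 r) x * ?t x ^ m)" for x
      using FD by simp
  qed (use it in simp)
  also have "\<dots> = 8 * r ^ 3 * (\<integral>x. indicat_real (cball 0 r) x * ?t x ^ m \<partial>lebesgue)" by simp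
  \<comment> \<open>Height r^4 / 4 of the cutoff against 8 r^3 = 2 * 4 r^3 from flux and gradient:
    multiplying by 4 gives 32, and r^3 cancels.\<close>
  finally have "r ^ 3 * (c * r * (\<integral>x. indicat_real (cball 0 (r / 2)) x * ?t x ^ (Q + m) \<partial>lebesgue))
     \<le> r ^ 3 * (32 * (\<integral>x. indicat_real (cball 0 r) x * ?t x ^ m \<partial>lebesgue))"
    by (simp add: power_numeral_reduce algebra_simps)
  then show ?thesis using r by (simp add: mult_le_cancel_left)
qed

subsection \<open>Vanishing of the sum\<close>


text \<open>Uses |k| \<le> |k|^p + 1. Besides the solution and its gradient, it covers the nonlinear
  right-hand sides, with p = 1.\<close>

lemma loc_int_of_Lp_loc:
  fixes h k :: "'a::euclidean_space \<Rightarrow> real"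
  assumes p: "p \<ge> 1" and k: "Lp_loc p k" and h: "h \<in> borel_measurable lebesgue" and le: "\<And>x. \<bar>h x\<bar> \<le> \<bar>k x\<bar>"
  shows "loc_int h"
  unfolding loc_int_def set_integrable_def
proof (intro conjI h allI impI)
  fix K :: "'a set" assume K: "compact K"
  have "integrable lebesgue (\<lambda>x. indicat_real K x *\<^sub>R \<bar>k x\<bar> powr p)"
    using k K by (simp add: Lp_loc_def set_integrable_def)
  moreover have "integrable lebesgue (\<lambda>x. indicat_real K x *\<^sub>R (1::real))"
    using loc_int_continuous[of "\<lambda>x::'a. 1"] K by (simp add: loc_int_def set_integrable_def)
  ultimately have i: "integrable lebesgue (\<lambda>x. indicat_real K x *\<^sub>R \<bar>k x\<bar> powr p + indicat_real K x *\<^sub>R (1::real))"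
    by (rule Bochner_Integration.integrable_add)
  show "integrable lebesgue (\<lambda>x. indicat_real K x *\<^sub>R h x)"
  proof (rule Bochner_Integration.integrable_bound[OF i])
    show "(\<lambda>x. indicat_real K x *\<^sub>R h x) \<in> borel_measurable lebesgue"
      using h K by (intro borel_measurable_scaleR borel_measurable_indicator) (auto simp: compact_imp_closed)
    have "\<bar>h x\<bar> \<le> \<bar>k x\<bar> powr p + 1" for x
    proof (cases "\<bar>k x\<bar> \<le> 1")
      case True
      then show ?thesis using le[of x] by (meson add_increasing order_trans powr_ge_zero)
    next
      case False
      then have "\<bar>k x\<bar> powr 1 \<le> \<bar>k x\<bar> powr p" using p by (intro powr_mono) auto
      then show ?thesis using le[of x] False by simp
    qed
    then show "AE x in lebesgue. norm (indicat_real K x *\<^sub>R h x)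
        \<le> norm (indicat_real K x *\<^sub>R \<bar>k x\<bar> powr p + indicat_real K x *\<^sub>R (1::real))"
      by (intro AE_I2) (auto split: split_indicator)
  qed
qed

lemma W1p_loc_loc_int:
  assumes p: "p \<ge> 1" and u: "W1p_loc p u g"
  shows "loc_int u" "i \<in> Basis \<Longrightarrow> loc_int (\<lambda>x. g x \<bullet> i)"
proof -
  show "loc_int u"
    using u by (intro loc_int_of_Lp_loc[OF p]) (auto simp: W1p_loc_def Lp_loc_def)
  have g: "g \<in> borel_measurable lebesgue" using u by (simp add: W1p_loc_def weak_gradient_def)
  show "loc_int (\<lambda>x. g x \<bullet> i)" if "i \<in> Basis"
    using u g Basis_le_norm[OF that]
    by (intro loc_int_of_Lp_loc[OF p, of "\<lambda>x. norm (g x)"]) (auto simp: W1p_loc_def)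
qed

lemma C1c_test_mult_integrable:
  fixes h :: "'a::euclidean_space \<Rightarrow> real"
  assumes C: "C1c_test \<phi> D" and h: "loc_int h"
  shows "integrable lebesgue (\<lambda>x. \<phi> x * h x)" "integrable lebesgue (\<lambda>x. (D x \<bullet> i) * h x)"
proof -
  obtain R where R: "R > 0" "\<And>x. R < norm x \<Longrightarrow> \<phi> x = 0 \<and> D x = 0"
    using C1c_test_support_ball[OF C] by blast
  have zero: "\<phi> x = 0" "D x = 0" if "x \<notin> cball 0 R" for x using R(2)[of x] that by auto
  obtain B where B: "B > 0" "\<And>x. \<bar>\<phi> x\<bar> \<le> B" "\<And>x. norm (D x) \<le> B"
    by (blast intro: C1c_test_bounded[OF C])
  have \<phi>m: "\<phi> \<in> borel_measurable lebesgue"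
    by (rule borel_measurable_lebesgue_continuous[OF C1c_test_continuous[OF C]])
  have Dm: "D \<in> borel_measurable lebesgue"
    using C unfolding C1c_test_def by (intro borel_measurable_lebesgue_continuous) auto
  show "integrable lebesgue (\<lambda>x. \<phi> x * h x)"
    by (rule loc_int_mult[OF h \<phi>m B(2) _ zero(1), of "cball 0 R"]) simp_all
  show "integrable lebesgue (\<lambda>x. (D x \<bullet> i) * h x)"
  proof (rule loc_int_mult[OF h, where K = "cball 0 R" and B = "B * norm i"])
    show "\<bar>D x \<bullet> i\<bar> \<le> B * norm i" for x
      using Cauchy_Schwarz_ineq2[of "D x" i] mult_right_mono[OF B(3)[of x], of "norm i"] by simp
  qed (use Dm zero in auto)
qed

lemma C1c_test_inner_integrable:
  fixes F :: "'a::euclidean_space \<Rightarrow> 'a"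
  assumes C: "C1c_test \<phi> D" and F: "F \<in> borel_measurable lebesgue" "\<And>x. norm (F x) \<le> M"
  shows "integrable lebesgue (\<lambda>x. F x \<bullet> D x)"
proof -
  obtain R where R: "R > 0" "\<And>x. R < norm x \<Longrightarrow> \<phi> x = 0 \<and> D x = 0"
    using C1c_test_support_ball[OF C] by blast
  obtain B where B: "B > 0" "\<And>x. \<bar>\<phi> x\<bar> \<le> B" "\<And>x. norm (D x) \<le> B"
    by (blast intro: C1c_test_bounded[OF C])
  have Dm: "D \<in> borel_measurable lebesgue"
    using C unfolding C1c_test_def by (intro borel_measurable_lebesgue_continuous) auto
  have M: "M \<ge> 0" using F(2)[of 0] norm_ge_zero order_trans by blast
  have "integrable lebesgue (\<lambda>x. (F x \<bullet> D x) * 1)"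
  proof (rule loc_int_mult[where K = "cball 0 R" and B = "M * B"])
    show "\<bar>F x \<bullet> D x\<bar> \<le> M * B" for x
      using Cauchy_Schwarz_ineq2[of "F x" "D x"] mult_mono[OF F(2)[of x] B(3)[of x] M] by simp
    show "F x \<bullet> D x = 0" if "x \<notin> cball 0 R" for x using R(2)[of x] that by simp
  qed (use F(1) Dm loc_int_continuous[of "\<lambda>x::'a. 1"] in auto)
  then show ?thesis by simp
qed

text \<open>Integrals are total and equal 0 for non-integrable functions, so additivity is not
  automatic: local integrability is what allows them to be split.\<close>

lemma weak_gradient_add:
  fixes u v :: "'a::euclidean_space \<Rightarrow> real"
  assumes "weak_gradient u g" "weak_gradient v h" "loc_int u" "loc_int v"
    and "\<And>i. i \<in> Basis \<Longrightarrow> loc_int (\<lambda>x. g x \<bullet> i)" "\<And>i. i \<in> Basis \<Longrightarrow> loc_int (\<lambda>x. h x \<bullet> i)"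
  shows "weak_gradient (\<lambda>x. u x + v x) (\<lambda>x. g x + h x)"
  unfolding weak_gradient_def
proof (intro conjI allI impI ballI)
  show "(\<lambda>x. g x + h x) \<in> borel_measurable lebesgue"
    using assms(1,2) by (intro borel_measurable_add) (auto simp: weak_gradient_def)
  fix \<phi> :: "'a \<Rightarrow> real" and D and i :: 'a assume C: "C1c_test \<phi> D" and i: "i \<in> Basis"
  note int = C1c_test_mult_integrable(2)[OF C assms(3), of i] C1c_test_mult_integrable(2)[OF C assms(4), of i]
    C1c_test_mult_integrable(1)[OF C assms(5)[OF i]] C1c_test_mult_integrable(1)[OF C assms(6)[OF i]]
  have "(\<integral>x. (u x + v x) * (D x \<bullet> i) \<partial>lebesgue) = (\<integral>x. (D x \<bullet> i) * u x + (D x \<bullet> i) * v x \<partial>lebesgue)"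
    by (simp add: algebra_simps)
  also have "\<dots> = (\<integral>x. (D x \<bullet> i) * u x \<partial>lebesgue) + (\<integral>x. (D x \<bullet> i) * v x \<partial>lebesgue)"
    by (rule Bochner_Integration.integral_add) (rule int)+
  also have "\<dots> = - (\<integral>x. \<phi> x * (g x \<bullet> i) \<partial>lebesgue) + - (\<integral>x. \<phi> x * (h x \<bullet> i) \<partial>lebesgue)"
    using assms(1,2) C i unfolding weak_gradient_def by (simp add: mult.commute[of "D _ \<bullet> i"])
  also have "\<dots> = - (\<integral>x. \<phi> x * (g x \<bullet> i) + \<phi> x * (h x \<bullet> i) \<partial>lebesgue)"
    using int by (simp del: integral_mult_right_zero)
  finally show "(\<integral>x. (u x + v x) * (D x \<bullet> i) \<partial>lebesgue) = - (\<integral>x. \<phi> x * ((g x + h x) \<bullet> i) \<partial>lebesgue)"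
    by (simp add: inner_add_left distrib_left)
qed

section \<open>Iteration over exponents and radii\<close>

lemma weak_sol_system_sum_zero:
  fixes u v :: "'a::euclidean_space \<Rightarrow> real"
  assumes q: "q > 1" and sol: "weak_sol_system q u v"
  shows "AE x in lebesgue. u x + v x = 0"
proof -
  obtain p gu gv where p: "p > 1" and u: "W1p_loc p u gu" and v: "W1p_loc p v gv"
    and uq: "Lp_loc 1 (\<lambda>x. \<bar>u x\<bar> powr q)" and vq: "Lp_loc 1 (\<lambda>x. \<bar>v x\<bar> powr q)"
    and eqs: "\<And>\<phi> D\<phi>. C1c_test \<phi> D\<phi> \<Longrightarrow>
       - (\<integral>x. mc_flux (gu x) \<bullet> D\<phi> x \<partial>lebesgue) = (\<integral>x. \<bar>v x\<bar> powr (q - 1) * v x * \<phi> x \<partial>lebesgue) \<and>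
       - (\<integral>x. mc_flux (gv x) \<bullet> D\<phi> x \<partial>lebesgue) = (\<integral>x. \<bar>u x\<bar> powr (q - 1) * u x * \<phi> x \<partial>lebesgue)"
    using sol unfolding weak_sol_system_def by blast
  have p': "p \<ge> 1" using p by simp
  note lu = W1p_loc_loc_int[OF p' u] and lv = W1p_loc_loc_int[OF p' v]
  have um: "u \<in> borel_measurable lebesgue" and vm: "v \<in> borel_measurable lebesgue"
    using lu(1) lv(1) by (simp_all add: loc_int_def)
  have gum: "gu \<in> borel_measurable lebesgue" and gvm: "gv \<in> borel_measurable lebesgue"
    using u v by (simp_all add: W1p_loc_def weak_gradient_def)
  have abs_pow: "\<bar>\<bar>s\<bar> powr (q - 1) * s\<bar> = \<bar>s\<bar> powr q" for s :: real
    using powr_add[of "\<bar>s\<bar>" "q - 1" 1] by (cases "s = 0") (simp_all add: abs_mult)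
  define fu where "fu x = \<bar>u x\<bar> powr (q - 1) * u x" for x
  define fv where "fv x = \<bar>v x\<bar> powr (q - 1) * v x" for x
  have fu: "loc_int fu"
    by (rule loc_int_of_Lp_loc[OF order_refl uq]) (use um in \<open>auto simp: fu_def[abs_def] abs_pow\<close>)
  have fv: "loc_int fv"
    by (rule loc_int_of_Lp_loc[OF order_refl vq]) (use vm in \<open>auto simp: fv_def[abs_def] abs_pow\<close>)
  define w where "w x = u x + v x" for x
  define f where "f x = fu x + fv x" for x
  define g where "g x = gu x + gv x" for x
  define F where "F x = mc_flux (gu x) + mc_flux (gv x)" for x
  have Fu: "(\<lambda>x. mc_flux (gu x)) \<in> borel_measurable lebesgue"
    and Fv: "(\<lambda>x. mc_flux (gv x)) \<in> borel_measurable lebesgue"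
    using measurable_compose[OF gum mc_flux_measurable] measurable_compose[OF gvm mc_flux_measurable] by auto
  have Fm: "F \<in> borel_measurable lebesgue" unfolding F_def[abs_def] using Fu Fv by simp
  have Fb: "norm (F x) \<le> 2" for x
    using norm_triangle_ineq[of "mc_flux (gu x)" "mc_flux (gv x)"] norm_mc_flux_le[of "gu x"] norm_mc_flux_le[of "gv x"]
    by (simp add: F_def)
  have f: "loc_int f" unfolding f_def[abs_def] using fu fv by (rule loc_int_add)
  have w: "loc_int w" unfolding w_def[abs_def] using lu(1) lv(1) by (rule loc_int_add)
  have g: "weak_gradient w g"
    unfolding w_def[abs_def] g_def[abs_def] using u v lu lv by (intro weak_gradient_add) (auto simp: W1p_loc_def)
  have gi: "loc_int (\<lambda>x. g x \<bullet> i)" if "i \<in> Basis" for i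
    unfolding g_def inner_add_left using lu(2)[OF that] lv(2)[OF that] by (rule loc_int_add)
  \<comment> \<open>Since the flux is odd, F = A(gu) - A(-gv) and g = gu - (-gv), so monotonicity
    applies to the pair gu, -gv.\<close>
  have Fg: "0 \<le> F x \<bullet> g x" for x
    using mc_flux_monotone[of "gu x" "- gv x"] by (simp add: F_def g_def mc_flux_minus)
  have eq: "- (\<integral>x. F x \<bullet> D\<phi> x \<partial>lebesgue) = (\<integral>x. f x * \<phi> x \<partial>lebesgue)" if C: "C1c_test \<phi> D\<phi>" for \<phi> D\<phi>
  proof -
    have "(\<integral>x. F x \<bullet> D\<phi> x \<partial>lebesgue) = (\<integral>x. mc_flux (gu x) \<bullet> D\<phi> x \<partial>lebesgue) + (\<integral>x. mc_flux (gv x) \<bullet> D\<phi> x \<partial>lebesgue)"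
      unfolding F_def inner_add_left
      using C1c_test_inner_integrable[OF C Fu norm_mc_flux_le] C1c_test_inner_integrable[OF C Fv norm_mc_flux_le]
      by (rule Bochner_Integration.integral_add)
    moreover have "(\<integral>x. f x * \<phi> x \<partial>lebesgue) = (\<integral>x. fu x * \<phi> x \<partial>lebesgue) + (\<integral>x. fv x * \<phi> x \<partial>lebesgue)"
      unfolding f_def distrib_right
      using C1c_test_mult_integrable(1)[OF C fu] C1c_test_mult_integrable(1)[OF C fv]
      by (intro Bochner_Integration.integral_add) (simp_all add: mult.commute)
    ultimately show ?thesis using eqs[OF C] by (simp add: fu_def fv_def)
  qed
  obtain n where n: "q \<le> real n" using real_arch_simple by blast
  \<comment> \<open>Doubling makes Q even, so all exponents 1 + j Q of the iteration are
    odd.\<close>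
  define Q where "Q = 2 * n"
  have Q: "even Q" "q \<le> real Q" using n q by (auto simp: Q_def)
  define I where "I m r = (\<integral>x. indicat_real (cball 0 r) x * \<bar>arctan (w x)\<bar> ^ m \<partial>lebesgue)" for m r
  have step: "(1 / 2) ^ Q * (2 * r) * I (Q + m) r \<le> 32 * I m (2 * r)" if "odd m" "r > 0" for m r
    using arctan_energy_step[OF Fm Fb f w g gi eq Fg that(1), of "(1 / 2) ^ Q" Q "2 * r"]
      odd_power_sum_arctan_ge[OF q Q(2) that(1)] that(2)
    by (simp add: I_def f_def w_def fu_def fv_def)
  have wm: "w \<in> borel_measurable lebesgue" using w by (simp add: loc_int_def)
  have int_ind: "integrable lebesgue (\<lambda>x. c * indicat_real (cball (0::'a) s) x)" for s c
    using loc_int_continuous[of "\<lambda>x::'a. 1"] by (simp add: loc_int_def set_integrable_def)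
  have it: "integrable lebesgue (\<lambda>x. indicat_real (cball 0 s) x * \<bar>arctan (w x)\<bar> ^ k)" for s k
  proof (rule Bochner_Integration.integrable_bound[OF int_ind[of "2 ^ k" s]])
    show "(\<lambda>x. indicat_real (cball 0 s) x * \<bar>arctan (w x)\<bar> ^ k) \<in> borel_measurable lebesgue"
      by (intro borel_measurable_times borel_measurable_indicator borel_measurable_power
        borel_measurable_abs measurable_compose[OF wm borel_measurable_arctan]) simp
    show "AE x in lebesgue. norm (indicat_real (cball 0 s) x * \<bar>arctan (w x)\<bar> ^ k) \<le> norm (2 ^ k * indicat_real (cball 0 s) x)"
      using power_mono[OF abs_arctan_le_2 abs_ge_zero] by (intro AE_I2) (auto split: split_indicator)
  qed
  let ?N = "DIM('a)"
  \<comment> \<open>Each step trades a power of r for Q more powers of t; the constant may depend on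
    j, but not on r.\<close>
  have bound: "\<exists>C\<ge>0. \<forall>r>0. I (1 + j * Q) r \<le> C * r ^ ?N / r ^ j" for j
  proof (induction j)
    case 0
    let ?V = "unit_ball_vol (real ?N)"
    \<comment> \<open>Start of the iteration: |arctan| \<le> 2 and the volume of the ball.\<close>
    have "I 1 r \<le> 2 * ?V * r ^ ?N" if "r > 0" for r
    proof -
      have "I 1 r \<le> (\<integral>x. 2 * indicat_real (cball (0::'a) r) x \<partial>lebesgue)"
        unfolding I_def using abs_arctan_le_2
        by (intro integral_mono it int_ind) (auto split: split_indicator)
      also have "\<dots> = 2 * ?V * r ^ ?N"
        using that content_cball[of r "0::'a"] by simp
      finally show ?thesis .
    qed
    then show ?case by (intro exI[of _ "2 * ?V"]) auto
  next
    case (Suc j)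
    then obtain C where C: "C \<ge> 0" "\<And>r. r > 0 \<Longrightarrow> I (1 + j * Q) r \<le> C * r ^ ?N / r ^ j" by blast
    \<comment> \<open>16 * 2^Q is 32 divided by the prefactor 2 (1/2)^Q of the step; the powers of 2
      in the bracket come from evaluating the previous bound at radius 2 r.\<close>
    define C' where "C' = 16 * 2 ^ Q * (C * 2 ^ ?N / 2 ^ j)"
    have "I (1 + Suc j * Q) r \<le> C' * r ^ ?N / r ^ Suc j" if r: "r > 0" for r
    proof -
      have "(1 / 2) ^ Q * (2 * r) * I (Q + (1 + j * Q)) r \<le> 32 * I (1 + j * Q) (2 * r)"
        by (rule step) (use Q r in auto)
      also have "\<dots> \<le> 32 * (C * (2 * r) ^ ?N / (2 * r) ^ j)"
        using C(2)[of "2 * r"] r by (intro mult_left_mono) auto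
      finally have "r * I (Q + (1 + j * Q)) r \<le> C' * r ^ ?N / r ^ j"
        using r by (simp add: C'_def power_mult_distrib power_divide field_simps)
      then have "I (Q + (1 + j * Q)) r \<le> C' * r ^ ?N / r ^ j / r"
        by (simp only: pos_le_divide_eq[OF r] mult.commute[of _ r])
      then show ?thesis by (simp add: ac_simps)
    qed
    moreover have "C' \<ge> 0" using C(1) by (simp add: C'_def)
    ultimately show ?case by blast
  qed
  \<comment> \<open>One step more than the dimension leaves the bound C / r, which tends to 0 at
    infinity.\<close>
  define k where "k = 1 + Suc ?N * Q"
  obtain C where C: "C \<ge> 0" "\<And>r. r > 0 \<Longrightarrow> I k r \<le> C * r ^ ?N / r ^ Suc ?N"
    using bound[of "Suc ?N"] unfolding k_def by blast
  \<comment> \<open>The integral increases with the radius, so a bound that vanishes at infinity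
    forces it to vanish on every ball.\<close>
  have Iz: "I k s = 0" for s
  proof -
    have nn: "0 \<le> I k s" unfolding I_def by (intro Bochner_Integration.integral_nonneg) simp
    have lim: "(\<lambda>n. C / real n) \<longlonglongrightarrow> 0" by (rule lim_const_over_n)
    have "\<forall>\<^sub>F n in sequentially. I k s \<le> C / real n"
      using eventually_ge_at_top[of "nat \<lceil>max 1 s\<rceil>"]
    proof eventually_elim
      case (elim n)
      then have n: "1 \<le> real n" "s \<le> real n" by linarith+
      have "I k s \<le> I k (real n)"
        unfolding I_def using n by (intro integral_mono it) (auto split: split_indicator)
      also have "\<dots> \<le> C * real n ^ ?N / real n ^ Suc ?N" using n by (intro C(2)) simp
      also have "\<dots> = C / real n" using n by simp
      finally show ?case .
    qed
    from tendsto_lowerbound[OF lim this] nn show ?thesis by simp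
  qed
  have "AE x in lebesgue. indicat_real (cball 0 (real n)) x * \<bar>arctan (w x)\<bar> ^ k = 0" for n
    using integral_nonneg_eq_0_iff_AE[OF it[of "real n" k]] Iz[of "real n"] unfolding I_def by simp
  \<comment> \<open>Countably many balls exhaust the space, so the exceptional null sets can be
    united.\<close>
  then have "AE x in lebesgue. \<forall>n. indicat_real (cball 0 (real n)) x * \<bar>arctan (w x)\<bar> ^ k = 0"
    by (subst AE_all_countable) (rule allI)
  then show ?thesis
  proof eventually_elim
    case (elim x)
    obtain n where "norm x \<le> real n" using real_arch_simple by blast
    then have "arctan (w x) = 0" using elim[rule_format, of n] by simp
    then show ?case by (simp add: w_def)
  qed
qed

section \<open>From the vanishing sum to the scalar equation\<close>

theorem theorem1p5:
  fixes u v :: "'a::euclidean_space \<Rightarrow> real" and q :: real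
  assumes "q > 1" and "weak_sol_system q u v"
  shows "(AE x in lebesgue. u x = - v x) \<and> weak_sol_scalar q u \<and> weak_sol_scalar q v \<and>
         ((AE x in lebesgue. u x \<ge> 0) \<and> (AE x in lebesgue. v x \<ge> 0) \<longrightarrow>
            (AE x in lebesgue. u x = 0) \<and> (AE x in lebesgue. v x = 0))"
proof -
  have zero: "AE x in lebesgue. u x + v x = 0" by (rule weak_sol_system_sum_zero[OF assms])
  obtain p gu gv where p: "p > 1" and u: "W1p_loc p u gu" and v: "W1p_loc p v gv"
    and uq: "Lp_loc 1 (\<lambda>x. \<bar>u x\<bar> powr q)" and vq: "Lp_loc 1 (\<lambda>x. \<bar>v x\<bar> powr q)"
    and eqs: "\<And>\<phi> D\<phi>. C1c_test \<phi> D\<phi> \<Longrightarrow>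
       - (\<integral>x. mc_flux (gu x) \<bullet> D\<phi> x \<partial>lebesgue) = (\<integral>x. \<bar>v x\<bar> powr (q - 1) * v x * \<phi> x \<partial>lebesgue) \<and>
       - (\<integral>x. mc_flux (gv x) \<bullet> D\<phi> x \<partial>lebesgue) = (\<integral>x. \<bar>u x\<bar> powr (q - 1) * u x * \<phi> x \<partial>lebesgue)"
    using assms(2) unfolding weak_sol_system_def by blast
  have um: "u \<in> borel_measurable lebesgue" and vm: "v \<in> borel_measurable lebesgue"
    using u v by (simp_all add: W1p_loc_def Lp_loc_def)
  \<comment> \<open>The nonlinearity is odd, so v = -u flips the sign of the right-hand side. This
    cancels the minus sign in front of the flux integral, and the original weak gradients witness
    the scalar equations.\<close>
  have swap: "(\<integral>x. \<bar>v x\<bar> powr (q - 1) * v x * \<phi> x \<partial>lebesgue) = - (\<integral>x. \<bar>u x\<bar> powr (q - 1) * u x * \<phi> x \<partial>lebesgue)"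
    if C: "C1c_test \<phi> D\<phi>" for \<phi> D\<phi>
  proof -
    have \<phi>m: "\<phi> \<in> borel_measurable lebesgue"
      by (rule borel_measurable_lebesgue_continuous[OF C1c_test_continuous[OF C]])
    have "(\<integral>x. \<bar>v x\<bar> powr (q - 1) * v x * \<phi> x \<partial>lebesgue) = (\<integral>x. - (\<bar>u x\<bar> powr (q - 1) * u x * \<phi> x) \<partial>lebesgue)"
    proof (rule integral_cong_AE)
      show "AE x in lebesgue. \<bar>v x\<bar> powr (q - 1) * v x * \<phi> x = - (\<bar>u x\<bar> powr (q - 1) * u x * \<phi> x)"
        using zero
      proof eventually_elim
        case (elim x)
        then have "v x = - u x" by simp
        then show ?case by simp
      qed
    qed (use um vm \<phi>m in auto)
    then show ?thesis by simp
  qed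
  have "weak_sol_scalar q u"
    unfolding weak_sol_scalar_def
  proof (intro exI conjI allI impI)
    fix \<phi> :: "'a \<Rightarrow> real" and D\<phi> assume C: "C1c_test \<phi> D\<phi>"
    show "(\<integral>x. mc_flux (gu x) \<bullet> D\<phi> x \<partial>lebesgue) = (\<integral>x. \<bar>u x\<bar> powr (q - 1) * u x * \<phi> x \<partial>lebesgue)"
      using eqs[OF C] swap[OF C] by linarith
  qed (fact p u uq)+
  moreover have "weak_sol_scalar q v"
    unfolding weak_sol_scalar_def
  proof (intro exI conjI allI impI)
    fix \<phi> :: "'a \<Rightarrow> real" and D\<phi> assume C: "C1c_test \<phi> D\<phi>"
    show "(\<integral>x. mc_flux (gv x) \<bullet> D\<phi> x \<partial>lebesgue) = (\<integral>x. \<bar>v x\<bar> powr (q - 1) * v x * \<phi> x \<partial>lebesgue)"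
      using eqs[OF C] swap[OF C] by linarith
  qed (fact p v vq)+
  moreover have "AE x in lebesgue. u x = - v x"
    using zero by eventually_elim (simp add: eq_neg_iff_add_eq_0)
  moreover have "(AE x in lebesgue. u x = 0) \<and> (AE x in lebesgue. v x = 0)"
    if "AE x in lebesgue. u x \<ge> 0" "AE x in lebesgue. v x \<ge> 0"
  proof
    show "AE x in lebesgue. u x = 0" using zero that by eventually_elim linarith
    show "AE x in lebesgue. v x = 0" using zero that by eventually_elim linarith
  qed
  ultimately show ?thesis by blast
qed

end
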